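(* Let $G$ be a countable group satisfying property RD with respect to a length function $\mathcal{L}$, and let $\mu$ be a probability measure on $G$ with finite Shannon entropy and with finite $\alpha$-moment with respect to $1+\mathcal{L}$ for some $\alpha>0$, i.e.\ $\sum_{s\in G}\mu(s)(1+\mathcal{L}(s))^\alpha<\infty$. Then \[ h(G,\mu)=c(G,\mu), \] that is, $h(G,\mu)=\lim_{p\to\infty}-p\log r_{\mathrm{PF}_q(G)}(\mu)$, where $\frac1p+\frac1q=1$.
   Context: $G$ is a countable discrete group with identity $e$. For probability measures $\mu,\nu$ on $G$, $\mu*\nu(s)=\sum_{t\in G}\mu(t)\nu(t^{-1}s)$, and $\mu^{*n}$ is the $n$-fold convolution power. The Shannon entropy is $H(G,\mu)=-\sum_{s}\mu(s)\log\mu(s)$ (with $0\log 0=0$), and the Avez entropy is $h(G,\mu)=\lim_{n\to\infty}\frac1n H(G,\mu^{*n})$. A length function is $\mathcal{L}:G\to[0,\infty)$ with $\mathcal{L}(e)=0$, $\mathcal{L}(s^{-1})=\mathcal{L}(s)$, $\mathcal{L}(st)\le\mathcal{L}(s)+\mathcal{L}(t)$. $G$ has property RD with respect to $\mathcal{L}$ if there is $d\in\mathbb{N}$ such that the inclusion $\mathbb{C}[G]\hookrightarrow C^*_r(G)$ extends to a bounded linear map $\ell^2(G,\omega)\to C^*_r(G)$, where $\omega(s)=(1+\mathcal{L}(s))^d$ and $\ell^2(G,\omega)=\{f:\sum_s|f(s)|^2\omega(s)^2<\infty\}$. For $1<q<\infty$, $\lambda_q:\ell^1(G)\to B(\ell^q(G))$,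 $\lambda_q(f)g=f*g$, is the left-regular representation, and $\mathrm{PF}_q(G)$ (the algebra of $q$-pseudofunctions) is the norm closure of $\lambda_q(\ell^1(G))$ in $B(\ell^q(G))$; $r_{\mathrm{PF}_q(G)}(\mu)$ denotes the spectral radius of $\lambda_q(\mu)$ in this Banach algebra. The convolution entropy is $c(G,\mu)=\lim_{p\to\infty}-p\log r_{\mathrm{PF}_q(G)}(\mu)$ with $\frac1p+\frac1q=1$. *)

theory Defs
  imports "HOL-Analysis.Analysis" "HOL-Library.Countable"
begin

text \<open>The group G is a type of class group_add (written additively, NOT assumed
commutative): identity 0, inverse uminus, product +.  Countability is the class countable.\<close>

definition conv :: "('g::group_add \<Rightarrow> 'a::real_normed_field) \<Rightarrow> ('g \<Rightarrow> 'a) \<Rightarrow> 'g \<Rightarrow> 'a" where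
  "conv f g s = (\<Sum>\<^sub>\<infinity>t. f t * g (- t + s))"

definition delta :: "'g::group_add \<Rightarrow> 'a::real_normed_field" where
  "delta s = (if s = 0 then 1 else 0)"

fun conv_pow :: "('g::group_add \<Rightarrow> 'a::real_normed_field) \<Rightarrow> nat \<Rightarrow> 'g \<Rightarrow> 'a" where
  "conv_pow f 0 = delta"
| "conv_pow f (Suc n) = conv f (conv_pow f n)"

definition prob_measure :: "('g \<Rightarrow> real) \<Rightarrow> bool" where
  "prob_measure \<mu> \<longleftrightarrow> (\<forall>s. \<mu> s \<ge> 0) \<and> (\<mu> has_sum 1) UNIV"

definition ent_term :: "real \<Rightarrow> real" where
  "ent_term x = (if x = 0 then 0 else - x * ln x)"

definition shannon_entropy :: "('g \<Rightarrow> real) \<Rightarrow> real" where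
  "shannon_entropy \<mu> = (\<Sum>\<^sub>\<infinity>s. ent_term (\<mu> s))"

definition finite_entropy :: "('g \<Rightarrow> real) \<Rightarrow> bool" where
  "finite_entropy \<mu> \<longleftrightarrow> (\<lambda>s. ent_term (\<mu> s)) summable_on UNIV"

definition length_function :: "('g::group_add \<Rightarrow> real) \<Rightarrow> bool" where
  "length_function L \<longleftrightarrow> (\<forall>s. L s \<ge> 0) \<and> L 0 = 0 \<and> (\<forall>s. L (- s) = L s)
     \<and> (\<forall>s t. L (s + t) \<le> L s + L t)"

definition in_lp :: "real \<Rightarrow> ('g \<Rightarrow> complex) \<Rightarrow> bool" where
  "in_lp q g \<longleftrightarrow> (\<lambda>s. norm (g s) powr q) summable_on UNIV"

definition lp_norm :: "real \<Rightarrow> ('g \<Rightarrow> complex) \<Rightarrow> real" where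
  "lp_norm q g = (\<Sum>\<^sub>\<infinity>s. norm (g s) powr q) powr (1 / q)"

definition in_l1 :: "('g \<Rightarrow> complex) \<Rightarrow> bool" where
  "in_l1 f \<longleftrightarrow> (\<lambda>s. norm (f s)) summable_on UNIV"

definition weighted_l2_norm :: "('g \<Rightarrow> real) \<Rightarrow> nat \<Rightarrow> ('g \<Rightarrow> complex) \<Rightarrow> real" where
  "weighted_l2_norm L d f = sqrt (\<Sum>\<^sub>\<infinity>s. (norm (f s))\<^sup>2 * ((1 + L s) ^ d)\<^sup>2)"

text \<open>Property RD: the map C[G] -> C*_r(G), f |-> lambda_2(f), is bounded for the norm of
  l^2(G,omega), i.e. the operator norm of lambda_2(f) on l^2(G) is at most C times the
  weighted norm of f, for all finitely supported f (boundedness on the dense subspace C[G]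
  is exactly the existence of the bounded extension).\<close>

definition property_RD :: "('g::group_add \<Rightarrow> real) \<Rightarrow> bool" where
  "property_RD L \<longleftrightarrow> (\<exists>d::nat. \<exists>C::real.
     \<forall>f :: 'g \<Rightarrow> complex. finite {s. f s \<noteq> 0} \<longrightarrow>
       (\<forall>g. in_lp 2 g \<longrightarrow> in_lp 2 (conv f g) \<and>
            lp_norm 2 (conv f g) \<le> C * weighted_l2_norm L d f * lp_norm 2 g))"

text \<open>Operators on l^q(G) are modelled as maps T :: (G => C) => (G => C); only their values
  on l^q(G) matter.  PF_q(G) is the set of operators mapping l^q into l^q that lie in the
  operator-norm closure of {lambda_q(f) | f in l^1(G)}.\<close>

definition PF :: "real \<Rightarrow> ((('g::group_add) \<Rightarrow> complex) \<Rightarrow> ('g \<Rightarrow> complex)) set" where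
  "PF q = {T. (\<forall>g. in_lp q g \<longrightarrow> in_lp q (T g)) \<and>
     (\<forall>\<epsilon>>0. \<exists>f. in_l1 f \<and>
        (\<forall>g. in_lp q g \<longrightarrow> lp_norm q (\<lambda>s. T g s - conv f g s) \<le> \<epsilon> * lp_norm q g))}"

text \<open>Spectrum of lambda_q(f) in the Banach algebra PF_q(G) (unit lambda_q(delta_e) = id):
  z is in the spectrum iff z - lambda_q(f) has no two-sided inverse in PF_q(G).\<close>

definition PF_spectrum :: "real \<Rightarrow> ('g::group_add \<Rightarrow> complex) \<Rightarrow> complex set" where
  "PF_spectrum q f = {z. \<not> (\<exists>B \<in> PF q.
      \<forall>g. in_lp q g \<longrightarrow>
        B (\<lambda>s. z * g s - conv f g s) = g \<and>
        (\<lambda>s. z * B g s - conv f (B g) s) = g)}"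

definition PF_spectral_radius :: "real \<Rightarrow> ('g::group_add \<Rightarrow> complex) \<Rightarrow> real" where
  "PF_spectral_radius q f = Sup (cmod ` PF_spectrum q f)"

definition avez_seq :: "('g::group_add \<Rightarrow> real) \<Rightarrow> nat \<Rightarrow> real" where
  "avez_seq \<mu> n = shannon_entropy (conv_pow \<mu> n) / real n"

definition conv_entropy_fun :: "('g::group_add \<Rightarrow> real) \<Rightarrow> real \<Rightarrow> real" where
  "conv_entropy_fun \<mu> p =
     - p * ln (PF_spectral_radius (p / (p - 1)) (\<lambda>s. complex_of_real (\<mu> s)))"

end

theory Submission
  imports Defs
begin

text \<open>
  Write \<open>q = 1 + \<epsilon>\<close>, so that \<open>1 / p = \<epsilon> / (1 + \<epsilon>)\<close>, and let \<open>r\<close> be the spectral radius of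
  \<open>\<lambda>\<^sub>q(\<mu>)\<close>. Since \<open>\<mu> \<ge> 0\<close>, \<open>r\<close> is the exponential growth rate of the norms of \<open>\<lambda>\<^sub>q(\<mu>\<^sup>*\<^sup>n)\<close>: the
  Neumann series gives the upper bound, and a positivity argument shows that the growth rate itself
  belongs to the spectrum.

  Applying \<open>\<lambda>\<^sub>q(\<mu>\<^sup>*\<^sup>n)\<close> to \<open>\<delta>\<close> bounds its norm from below by the \<open>\<ell>\<^sup>q\<close>-norm of \<open>\<mu>\<^sup>*\<^sup>n\<close>, and
  \<open>-p ln\<close> of that norm is a Renyi entropy of \<open>\<mu>\<^sup>*\<^sup>n\<close>, hence at most \<open>H(\<mu>\<^sup>*\<^sup>n)\<close>. So \<open>-p ln r \<le> h\<close>
  for every \<open>p\<close>. Conversely, interpolating RD with the trivial \<open>\<ell>\<^sup>1\<close>-bound gives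
  \<open>\<parallel>\<lambda>\<^sub>q(f)\<parallel> \<le> C\<^sup>2\<^sup>/\<^sup>p \<parallel>f \<omega>\<^sup>2\<^sup>/\<^sup>p\<parallel>\<^sub>q\<close> with \<open>\<omega> = (1 + L)\<^sup>d\<close>. With \<open>f = \<mu>\<^sup>*\<^sup>n\<close>, letting \<open>p\<close> tend to infinity yields
  \<open>liminf (-p ln r) \<ge> (H(\<mu>\<^sup>*\<^sup>n) - 2 ln C - 2 \<Sum> \<mu>\<^sup>*\<^sup>n ln \<omega>) / n\<close>, and the last sum is \<open>O(ln n)\<close> by
  concavity because \<open>(1 + L)\<^sup>\<alpha>\<close> is subadditive for \<open>\<alpha> \<le> 1\<close>.
\<close>

section \<open>\<open>\<ell>\<^sup>q\<close>-bounds\<close>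

text \<open>For \<open>0 \<le> c\<close> this is the closed ball of radius \<open>c\<close> in l^q.
  Testing only finite sums makes summability part of the bound and lets it pass to pointwise
  limits.\<close>

definition lp_le :: "real \<Rightarrow> real \<Rightarrow> ('g \<Rightarrow> real) \<Rightarrow> bool" where
  "lp_le q c f \<longleftrightarrow> (\<forall>F. finite F \<longrightarrow> (\<Sum>s\<in>F. \<bar>f s\<bar> powr q) \<le> c powr q)"

lemma lp_leD: "lp_le q c f \<Longrightarrow> finite F \<Longrightarrow> (\<Sum>s\<in>F. \<bar>f s\<bar> powr q) \<le> c powr q"
  by (simp add: lp_le_def)

text \<open>A single coordinate already obeys the bound. The resulting boundedness is what makes
  convolution with an l^1 function converge.\<close>

lemma lp_le_pointwise:
  assumes "lp_le q c f" "0 < q" "0 \<le> c"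
  shows "\<bar>f s\<bar> \<le> c"
proof (rule ccontr)
  assume "\<not> \<bar>f s\<bar> \<le> c"
  then have "c powr q < \<bar>f s\<bar> powr q"
    using assms by (intro powr_less_mono2) auto
  with lp_leD[OF assms(1), of "{s}"] show False by simp
qed

lemma lp_le_mono:
  assumes "lp_le q c f" "0 < q" "0 \<le> c" "c \<le> d" "\<And>s. \<bar>g s\<bar> \<le> \<bar>f s\<bar>"
  shows "lp_le q d g"
  unfolding lp_le_def
proof (intro allI impI)
  fix F :: "'a set" assume F: "finite F"
  have "(\<Sum>s\<in>F. \<bar>g s\<bar> powr q) \<le> (\<Sum>s\<in>F. \<bar>f s\<bar> powr q)"
    using assms by (intro sum_mono powr_mono2) auto
  also have "\<dots> \<le> c powr q" by (rule lp_leD[OF assms(1) F])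
  also have "\<dots> \<le> d powr q" using assms by (intro powr_mono2) auto
  finally show "(\<Sum>s\<in>F. \<bar>g s\<bar> powr q) \<le> d powr q" .
qed

lemma lp_le_scale:
  assumes "lp_le q c f" "0 \<le> c"
  shows "lp_le q (\<bar>a\<bar> * c) (\<lambda>s. a * f s)"
  unfolding lp_le_def
proof (intro allI impI)
  fix F :: "'a set" assume F: "finite F"
  have "(\<Sum>s\<in>F. \<bar>a * f s\<bar> powr q) = \<bar>a\<bar> powr q * (\<Sum>s\<in>F. \<bar>f s\<bar> powr q)"
    by (simp add: abs_mult powr_mult sum_distrib_left)
  also have "\<dots> \<le> \<bar>a\<bar> powr q * c powr q"
    by (intro mult_left_mono lp_leD[OF assms(1) F]) auto
  finally show "(\<Sum>s\<in>F. \<bar>a * f s\<bar> powr q) \<le> (\<bar>a\<bar> * c) powr q"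
    using assms by (simp add: powr_mult)
qed

lemma lp_le_translate:
  fixes f :: "'g::group_add \<Rightarrow> real"
  assumes "lp_le q c f"
  shows "lp_le q c (\<lambda>s. f (t + s))"
  unfolding lp_le_def
proof (intro allI impI)
  fix F :: "'g set" assume F: "finite F"
  have "(\<Sum>s\<in>F. \<bar>f (t + s)\<bar> powr q) = (\<Sum>s\<in>(+) t ` F. \<bar>f s\<bar> powr q)"
    by (subst sum.reindex) (auto simp: inj_on_def)
  also have "\<dots> \<le> c powr q" using F by (intro lp_leD[OF assms]) auto
  finally show "(\<Sum>s\<in>F. \<bar>f (t + s)\<bar> powr q) \<le> c powr q" .
qed

text \<open>Convexity of the power settles positive \<open>x\<close> and \<open>y\<close>; where one
  of them vanishes, \<open>w powr q \<le> w\<close> for \<open>w\<close> in [0,1] is enough.\<close>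

lemma powr_convex_nonneg:
  fixes x y u v q :: real
  assumes "0 \<le> x" "0 \<le> y" "0 \<le> u" "0 \<le> v" "u + v = 1" "1 \<le> q"
  shows "(u * x + v * y) powr q \<le> u * x powr q + v * y powr q"
proof -
  have *: "(w * z) powr q \<le> w * z powr q" if "0 \<le> w" "w \<le> 1" "0 \<le> z" for w z :: real
  proof (cases "w = 0")
    case False
    then have "w powr q \<le> w powr 1" using that assms by (intro powr_mono') auto
    then show ?thesis using that False by (simp add: powr_mult mult_right_mono)
  qed auto
  show ?thesis
  proof (cases "x = 0 \<or> y = 0")
    case True
    then show ?thesis using *[of u x] *[of v y] assms by auto
  next
    case False
    then show ?thesis
      using convex_onD[OF powr_convex[OF assms(6)], of v x y] assms
      by (auto simp: eq_diff_eq[THEN iffD2, OF \<open>u + v = 1\<close>])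
  qed
qed

text \<open>Minkowski's inequality from convexity: \<open>f + g\<close> is \<open>a + b\<close>
  times a convex combination of \<open>f / a\<close> and \<open>g / b\<close>, both in the unit
  ball. If \<open>a\<close> or \<open>b\<close> is 0, the corresponding function vanishes.\<close>

lemma lp_le_add:
  assumes f: "lp_le q a f" and g: "lp_le q b g" and "1 \<le> q" "0 \<le> a" "0 \<le> b"
  shows "lp_le q (a + b) (\<lambda>s. f s + g s)"
proof (cases "a = 0 \<or> b = 0")
  case True
  moreover have "\<And>s. f s = 0" if "a = 0" using lp_le_pointwise[OF f] that assms by force
  moreover have "\<And>s. g s = 0" if "b = 0" using lp_le_pointwise[OF g] that assms by force
  ultimately show ?thesis using f g by auto
next
  case False
  then have ab: "a > 0" "b > 0" using assms by auto
  define u where "u = a / (a + b)"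
  define v where "v = b / (a + b)"
  have uv: "u \<ge> 0" "v \<ge> 0" "u + v = 1" using ab by (auto simp: u_def v_def add_divide_distrib[symmetric])
  show ?thesis unfolding lp_le_def
  proof (intro allI impI)
    fix F :: "'a set" assume F: "finite F"
    have "\<bar>f s + g s\<bar> powr q \<le> (a + b) powr q * (u * (\<bar>f s\<bar> powr q / a powr q) + v * (\<bar>g s\<bar> powr q / b powr q))" for s
    proof -
      have "\<bar>f s + g s\<bar> powr q \<le> ((a + b) * (u * (\<bar>f s\<bar> / a) + v * (\<bar>g s\<bar> / b))) powr q"
      proof (rule powr_mono2)
        have "(a + b) * (u * (\<bar>f s\<bar> / a) + v * (\<bar>g s\<bar> / b)) = \<bar>f s\<bar> + \<bar>g s\<bar>"
          using ab by (simp add: u_def v_def distrib_left)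
        then show "\<bar>f s + g s\<bar> \<le> (a + b) * (u * (\<bar>f s\<bar> / a) + v * (\<bar>g s\<bar> / b))" by simp
      qed (use assms in auto)
      also have "\<dots> = (a + b) powr q * (u * (\<bar>f s\<bar> / a) + v * (\<bar>g s\<bar> / b)) powr q"
        using ab uv by (subst powr_mult) auto
      also have "\<dots> \<le> (a + b) powr q * (u * (\<bar>f s\<bar> / a) powr q + v * (\<bar>g s\<bar> / b) powr q)"
        using ab uv assms by (intro mult_left_mono powr_convex_nonneg) auto
      finally show ?thesis using ab by (simp add: powr_divide)
    qed
    then have "(\<Sum>s\<in>F. \<bar>f s + g s\<bar> powr q) \<le>
      (\<Sum>s\<in>F. (a + b) powr q * (u * (\<bar>f s\<bar> powr q / a powr q) + v * (\<bar>g s\<bar> powr q / b powr q)))"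
      by (rule sum_mono)
    also have "\<dots> = (a + b) powr q * (u * ((\<Sum>s\<in>F. \<bar>f s\<bar> powr q) / a powr q) + v * ((\<Sum>s\<in>F. \<bar>g s\<bar> powr q) / b powr q))"
      by (simp add: sum_distrib_left sum.distrib sum_divide_distrib distrib_left)
    also have "\<dots> \<le> (a + b) powr q * (u * 1 + v * 1)"
      using ab uv lp_leD[OF f F] lp_leD[OF g F]
      by (intro mult_left_mono add_mono) (auto simp: field_simps)
    finally show "(\<Sum>s\<in>F. \<bar>f s + g s\<bar> powr q) \<le> (a + b) powr q" using uv by simp
  qed
qed

lemma lp_le_zero: "lp_le q 0 (\<lambda>s. 0)"
  by (simp add: lp_le_def)

lemma lp_le_sum:
  assumes "finite I" "\<And>i. i \<in> I \<Longrightarrow> lp_le q (c i) (u i)" "\<And>i. i \<in> I \<Longrightarrow> 0 \<le> c i" "1 \<le> q"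
  shows "lp_le q (\<Sum>i\<in>I. c i) (\<lambda>s. \<Sum>i\<in>I. u i s)"
  using assms
proof (induction I rule: finite_induct)
  case (insert i I)
  then show ?case by (simp add: lp_le_add sum_nonneg)
qed (simp add: lp_le_zero)

text \<open>A Fatou property: every finite sum in \<open>lp_le\<close> is continuous for pointwise
  convergence.\<close>

lemma lp_le_lim:
  assumes "G \<noteq> bot" "0 < q" "\<And>s. ((\<lambda>i. f i s) \<longlongrightarrow> g s) G" "eventually (\<lambda>i. lp_le q c (f i)) G"
  shows "lp_le q c g"
  unfolding lp_le_def
proof (intro allI impI)
  fix F :: "'b set" assume F: "finite F"
  have "((\<lambda>i. \<Sum>s\<in>F. \<bar>f i s\<bar> powr q) \<longlongrightarrow> (\<Sum>s\<in>F. \<bar>g s\<bar> powr q)) G"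
    using assms(2,3) by (intro tendsto_sum tendsto_powr' tendsto_rabs tendsto_const) auto
  then show "(\<Sum>s\<in>F. \<bar>g s\<bar> powr q) \<le> c powr q"
    by (rule tendsto_upperbound) (use assms(1,4) F in \<open>auto elim!: eventually_mono dest: lp_leD\<close>)
qed

text \<open>Young's inequality for convolution by an
  \<open>\<ell>\<^sup>1\<close> function and the convergence of the Neumann series are both instances of this form of Minkowski's inequality.\<close>

lemma lp_le_infsum:
  assumes u: "\<And>i. i \<in> I \<Longrightarrow> lp_le q (c i) (u i)" and c: "\<And>i. i \<in> I \<Longrightarrow> 0 \<le> c i"
    and sc: "c summable_on I" and q: "1 \<le> q"
  shows "lp_le q (\<Sum>\<^sub>\<infinity>i\<in>I. c i) (\<lambda>s. \<Sum>\<^sub>\<infinity>i\<in>I. u i s)"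
proof -
  have "(\<lambda>i. norm (u i s)) summable_on I" for s
    by (rule summable_on_comparison_test[OF sc]) (use lp_le_pointwise[OF u _ c] q in auto)
  then have "(\<lambda>i. u i s) summable_on I" for s by (rule abs_summable_summable)
  then have *: "(sum (\<lambda>i. u i s) \<longlongrightarrow> (\<Sum>\<^sub>\<infinity>i\<in>I. u i s)) (finite_subsets_at_top I)" for s
    using has_sum_def has_sum_infsum by blast
  show ?thesis
  proof (rule lp_le_lim[OF _ _ *])
    show "\<forall>\<^sub>F J in finite_subsets_at_top I. lp_le q (\<Sum>\<^sub>\<infinity>i\<in>I. c i) (\<lambda>s. \<Sum>i\<in>J. u i s)"
    proof (rule eventually_finite_subsets_at_top_weakI)
      fix J assume J: "finite J" "J \<subseteq> I"
      have "lp_le q (\<Sum>i\<in>J. c i) (\<lambda>s. \<Sum>i\<in>J. u i s)"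
        using J u c q by (intro lp_le_sum) auto
      moreover have "(\<Sum>i\<in>J. c i) \<le> (\<Sum>\<^sub>\<infinity>i\<in>I. c i)"
        using J sc c by (intro finite_sum_le_infsum) auto
      ultimately show "lp_le q (\<Sum>\<^sub>\<infinity>i\<in>I. c i) (\<lambda>s. \<Sum>i\<in>J. u i s)"
        using J c q by (elim lp_le_mono) (auto intro: sum_nonneg)
    qed
  qed (use q in auto)
qed

text \<open>Bridge to the given definitions. \<open>in_lp\<close> has to accompany the norm bound,
  since \<open>lp_norm\<close> takes the default value 0 when the sum diverges.\<close>

lemma lp_le_iff_lp_norm:
  assumes "0 < q" "0 \<le> c"
  shows "lp_le q c (\<lambda>s. norm (g s)) \<longleftrightarrow> in_lp q g \<and> lp_norm q g \<le> c"
proof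
  assume *: "lp_le q c (\<lambda>s. norm (g s))"
  have 1: "in_lp q g" unfolding in_lp_def
    by (rule nonneg_bdd_above_summable_on) (use lp_leD[OF *] in \<open>auto intro!: bdd_aboveI\<close>)
  then have "(\<Sum>\<^sub>\<infinity>s. norm (g s) powr q) \<le> c powr q"
    unfolding in_lp_def by (rule infsum_le_finite_sums) (use lp_leD[OF *] in auto)
  then have "lp_norm q g \<le> (c powr q) powr (1 / q)"
    unfolding lp_norm_def using assms by (intro powr_mono2) (auto intro: infsum_nonneg)
  then show "in_lp q g \<and> lp_norm q g \<le> c" using 1 assms by (simp add: powr_powr)
next
  assume *: "in_lp q g \<and> lp_norm q g \<le> c"
  show "lp_le q c (\<lambda>s. norm (g s))" unfolding lp_le_def
  proof (intro allI impI)
    fix F :: "'a set" assume F: "finite F"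
    have "(\<Sum>s\<in>F. \<bar>norm (g s)\<bar> powr q) \<le> (\<Sum>\<^sub>\<infinity>s. norm (g s) powr q)"
      using * F by (simp add: in_lp_def finite_sum_le_infsum)
    also have "\<dots> = lp_norm q g powr q"
      using assms by (simp add: lp_norm_def powr_powr infsum_nonneg)
    also have "\<dots> \<le> c powr q" using * assms by (intro powr_mono2) (auto simp: lp_norm_def)
    finally show "(\<Sum>s\<in>F. \<bar>norm (g s)\<bar> powr q) \<le> c powr q" .
  qed
qed

lemma lp_norm_nonneg: "0 \<le> lp_norm q g"
  by (simp add: lp_norm_def)

text \<open>After dividing by the two total sums, this is the weighted arithmetic-geometric
  inequality summed over \<open>I\<close>. The exponents \<open>x\<close> and \<open>1 - x\<close>
  are those needed for interpolation.\<close>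

lemma Holder_sum:
  fixes a b :: "'i \<Rightarrow> real"
  assumes "finite I" "\<And>i. i \<in> I \<Longrightarrow> 0 \<le> a i" "\<And>i. i \<in> I \<Longrightarrow> 0 \<le> b i" "0 < x" "x < 1"
  shows "(\<Sum>i\<in>I. a i powr x * b i powr (1 - x)) \<le> (\<Sum>i\<in>I. a i) powr x * (\<Sum>i\<in>I. b i) powr (1 - x)"
proof (cases "(\<Sum>i\<in>I. a i) = 0 \<or> (\<Sum>i\<in>I. b i) = 0")
  case True
  then have "(\<forall>i\<in>I. a i = 0) \<or> (\<forall>i\<in>I. b i = 0)"
    using assms by (auto simp: sum_nonneg_eq_0_iff)
  then have "(\<Sum>i\<in>I. a i powr x * b i powr (1 - x)) = 0" by (auto intro!: sum.neutral)
  then show ?thesis by simp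
next
  case False
  define A where "A = (\<Sum>i\<in>I. a i)"
  define B where "B = (\<Sum>i\<in>I. b i)"
  have AB: "A > 0" "B > 0" using False assms by (auto simp: A_def B_def order_less_le sum_nonneg)
  have "a i powr x * b i powr (1 - x) \<le> A powr x * B powr (1 - x) * (x * (a i / A) + (1 - x) * (b i / B))"
    if i: "i \<in> I" for i
  proof -
    have "(a i / A) powr x * (b i / B) powr (1 - x) \<le> x * (a i / A) + (1 - x) * (b i / B)"
    proof (cases "a i = 0 \<or> b i = 0")
      case True
      then show ?thesis using assms i AB by auto
    next
      case False
      then have "0 < a i" "0 < b i" using assms(2,3)[OF i] by auto
      then show ?thesis using assms i AB by (intro Youngs_inequality_0) auto
    qed
    then have "A powr x * B powr (1 - x) * ((a i / A) powr x * (b i / B) powr (1 - x)) \<le>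
        A powr x * B powr (1 - x) * (x * (a i / A) + (1 - x) * (b i / B))"
      using AB by (intro mult_left_mono) auto
    then show ?thesis using AB assms i by (simp add: powr_divide field_simps)
  qed
  then have "(\<Sum>i\<in>I. a i powr x * b i powr (1 - x)) \<le>
     (\<Sum>i\<in>I. A powr x * B powr (1 - x) * (x * (a i / A) + (1 - x) * (b i / B)))"
    by (rule sum_mono)
  also have "\<dots> = A powr x * B powr (1 - x) * (x * ((\<Sum>i\<in>I. a i) / A) + (1 - x) * ((\<Sum>i\<in>I. b i) / B))"
    by (simp add: sum_distrib_left sum.distrib sum_divide_distrib distrib_left)
  also have "\<dots> = A powr x * B powr (1 - x)" using AB by (simp add: A_def B_def)
  finally show ?thesis by (simp add: A_def B_def)
qed

section \<open>Convolution\<close>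

text \<open>An l^1 function against a bounded one is the common setting of most identities below;
  l^q functions fit in as second factor through \<open>lp_le_pointwise\<close>.\<close>

lemma summable_on_conv:
  fixes f g :: "'g::group_add \<Rightarrow> 'a::{real_normed_field,banach}"
  assumes f: "(\<lambda>t. norm (f t)) summable_on UNIV" and g: "\<And>s. norm (g s) \<le> c"
  shows "(\<lambda>t. norm (f t * g (- t + s))) summable_on UNIV" "(\<lambda>t. f t * g (- t + s)) summable_on UNIV"
proof -
  have "(\<lambda>t. norm (f t) * c) summable_on UNIV" by (rule summable_on_cmult_left[OF f])
  then show 1: "(\<lambda>t. norm (f t * g (- t + s))) summable_on UNIV"
    by (rule Infinite_Sum.abs_summable_on_comparison_test') (simp add: norm_mult g mult_left_mono)
  then show "(\<lambda>t. f t * g (- t + s)) summable_on UNIV" by (rule abs_summable_summable)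
qed

lemma has_sum_conv:
  fixes f g :: "'g::group_add \<Rightarrow> 'a::{real_normed_field,banach}"
  assumes "(\<lambda>t. norm (f t)) summable_on UNIV" "\<And>s. norm (g s) \<le> c"
  shows "((\<lambda>t. f t * g (- t + s)) has_sum conv f g s) UNIV"
  unfolding conv_def using summable_on_conv(2)[OF assms] by (rule has_sum_infsum)

lemma norm_le_infsum_norm:
  fixes f :: "'g \<Rightarrow> 'a::real_normed_vector"
  assumes "(\<lambda>t. norm (f t)) summable_on UNIV"
  shows "norm (f s) \<le> (\<Sum>\<^sub>\<infinity>t. norm (f t))"
  using finite_sum_le_infsum[OF assms, of "{s}"] by simp

text \<open>The bijection is \<open>v = t + u\<close>. The free test function \<open>\<phi>\<close>
  lets one statement serve total mass, associativity and moments.\<close>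

lemma conv_change_of_variables:
  fixes f h \<phi> :: "'g::group_add \<Rightarrow> 'a::{real_normed_field,banach}"
  assumes "((\<lambda>(t, u). f t * h u * \<phi> (t + u)) has_sum S) UNIV"
    and "\<And>v. (\<lambda>t. f t * h (- t + v)) summable_on UNIV"
  shows "((\<lambda>v. conv f h v * \<phi> v) has_sum S) UNIV"
proof -
  have "((\<lambda>(v, t). f t * h (- t + v) * \<phi> v) has_sum S) (UNIV \<times> UNIV) \<longleftrightarrow>
        ((\<lambda>(t, u). f t * h u * \<phi> (t + u)) has_sum S) UNIV"
    by (rule has_sum_reindex_bij_witness[where j = "\<lambda>(v, t). (t, - t + v)" and i = "\<lambda>(t, u). (t + u, t)"])
       (auto simp: add.assoc[symmetric])
  with assms have "((\<lambda>(v, t). f t * h (- t + v) * \<phi> v) has_sum S) (UNIV \<times> UNIV)" by simp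
  then show ?thesis
  proof (rule has_sum_SigmaD)
    show "((\<lambda>t. case (v, t) of (v, t) \<Rightarrow> f t * h (- t + v) * \<phi> v) has_sum conv f h v * \<phi> v) UNIV" for v
      using has_sum_cmult_left[OF has_sum_infsum[OF assms(2)[of v]], of "\<phi> v"] by (simp add: conv_def)
  qed
qed

lemma summable_on_product_mult:
  fixes f h :: "'g \<Rightarrow> real"
  assumes "f summable_on UNIV" "h summable_on UNIV" "\<And>t. 0 \<le> f t" "\<And>t. 0 \<le> h t"
  shows "(\<lambda>(t, u). f t * h u) summable_on UNIV"
proof -
  have "(\<lambda>(t, u). f t * h u) summable_on (UNIV \<times> UNIV)"
  proof (rule summable_on_SigmaI)
    show "((\<lambda>y. case (x, y) of (t, u) \<Rightarrow> f t * h u) has_sum f x * (\<Sum>\<^sub>\<infinity>u. h u)) UNIV" for x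
      using has_sum_cmult_right[OF has_sum_infsum[OF assms(2)], of "f x"] by simp
  qed (use assms in \<open>auto intro: summable_on_cmult_left\<close>)
  then show ?thesis by simp
qed

lemma summable_on_conv_triple:
  fixes f h \<phi> :: "'g::group_add \<Rightarrow> 'a::{real_normed_field,banach}"
  assumes "(\<lambda>t. norm (f t)) summable_on UNIV" "(\<lambda>t. norm (h t)) summable_on UNIV" "\<And>s. norm (\<phi> s) \<le> c"
  shows "(\<lambda>(t, u). f t * h u * \<phi> (t + u)) summable_on UNIV"
proof -
  have "(\<lambda>(t, u). norm (f t) * norm (h u)) summable_on UNIV"
    by (rule summable_on_product_mult[OF assms(1,2)]) auto
  then have "(\<lambda>x. (case x of (t, u) \<Rightarrow> norm (f t) * norm (h u)) * c) summable_on UNIV"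
    by (rule summable_on_cmult_left)
  then have "(\<lambda>x. norm (case x of (t, u) \<Rightarrow> f t * h u * \<phi> (t + u))) summable_on UNIV"
    by (rule Infinite_Sum.abs_summable_on_comparison_test')
       (auto simp: norm_mult intro!: mult_left_mono assms(3))
  then show ?thesis by (rule abs_summable_summable)
qed

text \<open>Take the change of variables for the norms of both factors with \<open>\<phi>\<close>
  constantly 1; the result dominates \<open>norm (conv f h v)\<close>.\<close>

lemma conv_l1:
  fixes f h :: "'g::group_add \<Rightarrow> 'a::{real_normed_field,banach}"
  assumes f: "(\<lambda>t. norm (f t)) summable_on UNIV" and h: "(\<lambda>t. norm (h t)) summable_on UNIV"
  shows "(\<lambda>v. norm (conv f h v)) summable_on UNIV"
proof -
  have f': "(\<lambda>t. norm (norm (f t))) summable_on UNIV" and h': "(\<lambda>t. norm (norm (h t))) summable_on UNIV"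
    using f h by auto
  have b: "norm (norm (h s)) \<le> (\<Sum>\<^sub>\<infinity>t. norm (h t))" for s
    using norm_le_infsum_norm[OF h] by simp
  have "(\<lambda>(t, u). norm (f t) * norm (h u) * 1) summable_on UNIV"
    using summable_on_conv_triple[OF f' h', of "\<lambda>_. 1" 1] by simp
  from conv_change_of_variables[OF has_sum_infsum[OF this] summable_on_conv(2)[OF f' b]]
  have "(\<lambda>v. conv (\<lambda>t. norm (f t)) (\<lambda>t. norm (h t)) v) summable_on UNIV"
    by (auto simp: has_sum_iff)
  then show ?thesis
  proof (rule Infinite_Sum.abs_summable_on_comparison_test')
    show "norm (conv f h v) \<le> conv (\<lambda>t. norm (f t)) (\<lambda>t. norm (h t)) v" for v
      using norm_infsum_bound[OF summable_on_conv(1)[where s = v and g = h, OF f norm_le_infsum_norm[OF h]]]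
      by (simp add: conv_def norm_mult)
  qed
qed

text \<open>Both sides are iterated evaluations of one absolutely convergent double sum
  \<open>S\<close>.\<close>

lemma conv_assoc:
  fixes f h g :: "'g::group_add \<Rightarrow> 'a::{real_normed_field,banach}"
  assumes f: "(\<lambda>t. norm (f t)) summable_on UNIV" and h: "(\<lambda>t. norm (h t)) summable_on UNIV"
    and g: "\<And>s. norm (g s) \<le> c"
  shows "conv (conv f h) g = conv f (conv h g)"
proof
  fix s
  define S where "S = (\<Sum>\<^sub>\<infinity>(t, u). f t * h u * g (- (t + u) + s))"
  have S: "((\<lambda>(t, u). f t * h u * g (- (t + u) + s)) has_sum S) UNIV"
    unfolding S_def
    by (rule has_sum_infsum, rule summable_on_conv_triple[OF f h, where \<phi> = "\<lambda>v. g (- v + s)"]) (rule g)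
  have "((\<lambda>v. conv f h v * g (- v + s)) has_sum S) UNIV"
    by (rule conv_change_of_variables[OF S summable_on_conv(2)[OF f norm_le_infsum_norm[OF h]]])
  then have 1: "conv (conv f h) g s = S"
    by (simp add: conv_def[of "conv f h"] infsumI)
  have "((\<lambda>t. f t * conv h g (- t + s)) has_sum S) UNIV"
  proof (rule has_sum_SigmaD)
    show "((\<lambda>(t, u). f t * h u * g (- (t + u) + s)) has_sum S) (UNIV \<times> UNIV)" using S by simp
    show "((\<lambda>y. case (t, y) of (t, u) \<Rightarrow> f t * h u * g (- (t + u) + s)) has_sum f t * conv h g (- t + s)) UNIV" for t
      using has_sum_cmult_right[OF has_sum_conv[where s = "- t + s" and g = g, OF h g], of "f t"]
      by (simp add: minus_add add.assoc mult.assoc del: add_uminus_conv_diff)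
  qed
  then have "conv f (conv h g) s = S"
    by (simp add: conv_def[of f] infsumI)
  with 1 show "conv (conv f h) g s = conv f (conv h g) s" by simp
qed

lemma conv_delta_left:
  fixes g :: "'g::group_add \<Rightarrow> 'a::real_normed_field"
  shows "conv delta g = g"
proof
  fix s
  have "((\<lambda>t. delta t * g (- t + s)) has_sum g s) UNIV"
    by (rule has_sum_finite_neutralI[of "{0}"]) (auto simp: delta_def)
  then show "conv delta g s = g s" by (simp add: conv_def infsumI)
qed

lemma conv_delta_right:
  fixes f :: "'g::group_add \<Rightarrow> 'a::real_normed_field"
  shows "conv f delta = f"
proof
  fix s
  have "((\<lambda>t. f t * delta (- t + s)) has_sum f s) UNIV"
    by (rule has_sum_finite_neutralI[of "{s}"]) (auto simp: delta_def dest!: minus_unique)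
  then show "conv f delta s = f s" by (simp add: conv_def infsumI)
qed

text \<open>Summability need not be assumed: if it fails, it fails on both sides and both values are
  the default 0.\<close>

lemma conv_of_real:
  "conv (\<lambda>s. complex_of_real (f s)) (\<lambda>s. complex_of_real (g s)) s = complex_of_real (conv f g s)"
proof (cases "(\<lambda>t. f t * g (- t + s)) summable_on UNIV")
  case True
  from has_sum_of_real[OF has_sum_infsum[OF True], where ?'a = complex] show ?thesis
    by (simp add: conv_def infsumI)
next
  case False
  then have "\<not> (\<lambda>t. complex_of_real (f t * g (- t + s))) summable_on UNIV"
    using summable_on_Re[of "\<lambda>t. complex_of_real (f t * g (- t + s))" UNIV] by auto
  then have "conv (\<lambda>s. complex_of_real (f s)) (\<lambda>s. complex_of_real (g s)) s = 0"
    unfolding conv_def by (intro infsum_not_exists) simp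
  with False show ?thesis by (simp add: conv_def infsum_not_exists)
qed

lemma conv_scale_left:
  fixes f g :: "'g::group_add \<Rightarrow> 'a::real_normed_field"
  shows "conv (\<lambda>s. a * f s) g s = a * conv f g s"
  by (simp add: conv_def mult.assoc infsum_cmult_right')

lemma conv_scale_right:
  fixes f g :: "'g::group_add \<Rightarrow> 'a::real_normed_field"
  shows "conv f (\<lambda>s. a * g s) s = a * conv f g s"
  by (simp add: conv_def mult.left_commute[of _ a] infsum_cmult_right')

lemma has_sum_sum:
  fixes f :: "'i \<Rightarrow> 'b \<Rightarrow> 'a::topological_comm_monoid_add"
  assumes "\<And>i. i \<in> I \<Longrightarrow> (f i has_sum S i) A"
  shows "((\<lambda>x. \<Sum>i\<in>I. f i x) has_sum (\<Sum>i\<in>I. S i)) A"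
  using assms by (induction I rule: infinite_finite_induct) (auto intro: has_sum_add)

lemma conv_sum_left:
  fixes f :: "'i \<Rightarrow> 'g::group_add \<Rightarrow> 'a::{real_normed_field,banach}"
  assumes "\<And>i. i \<in> I \<Longrightarrow> (\<lambda>t. norm (f i t)) summable_on UNIV" "\<And>s. norm (g s) \<le> c"
  shows "conv (\<lambda>s. \<Sum>i\<in>I. f i s) g s = (\<Sum>i\<in>I. conv (f i) g s)"
proof -
  have "((\<lambda>t. \<Sum>i\<in>I. f i t * g (- t + s)) has_sum (\<Sum>i\<in>I. conv (f i) g s)) UNIV"
    by (rule has_sum_sum) (rule has_sum_conv[OF assms])
  then show ?thesis by (simp add: conv_def[of "\<lambda>s. \<Sum>i\<in>I. f i s"] sum_distrib_right infsumI)
qed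

lemma conv_sum_right:
  fixes f :: "'g::group_add \<Rightarrow> 'a::{real_normed_field,banach}"
  assumes "(\<lambda>t. norm (f t)) summable_on UNIV" "\<And>i s. i \<in> I \<Longrightarrow> norm (g i s) \<le> c i"
  shows "conv f (\<lambda>s. \<Sum>i\<in>I. g i s) s = (\<Sum>i\<in>I. conv f (g i) s)"
proof -
  have "((\<lambda>t. \<Sum>i\<in>I. f t * g i (- t + s)) has_sum (\<Sum>i\<in>I. conv f (g i) s)) UNIV"
    by (rule has_sum_sum) (rule has_sum_conv[OF assms])
  then show ?thesis by (simp add: conv_def[of f "\<lambda>s. \<Sum>i\<in>I. g i s"] sum_distrib_left infsumI)
qed

lemma conv_diff_right:
  fixes f :: "'g::group_add \<Rightarrow> 'a::{real_normed_field,banach}"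
  assumes "(\<lambda>t. norm (f t)) summable_on UNIV" "\<And>s. norm (g s) \<le> c" "\<And>s. norm (h s) \<le> d"
  shows "conv f (\<lambda>s. g s - h s) s = conv f g s - conv f h s"
  using infsumI[OF has_sum_add[OF has_sum_conv[where s = s and g = g, OF assms(1,2)]
      has_sum_uminusI[OF has_sum_conv[where s = s and g = h, OF assms(1,3)]]]]
  by (simp add: conv_def[of f "\<lambda>s. g s - h s"] right_diff_distrib)

lemma norm_conv_le:
  fixes f g :: "'g::group_add \<Rightarrow> 'a::{real_normed_field,banach}"
  assumes "(\<lambda>t. norm (f t)) summable_on UNIV" "\<And>s. norm (g s) \<le> c"
  shows "norm (conv f g s) \<le> conv (\<lambda>t. norm (f t)) (\<lambda>t. norm (g t)) s"
  using norm_infsum_bound[OF summable_on_conv(1)[where s = s and g = g, OF assms]] by (simp add: conv_def norm_mult)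

lemma conv_nonneg:
  fixes f g :: "'g::group_add \<Rightarrow> real"
  shows "(\<And>s. 0 \<le> f s) \<Longrightarrow> (\<And>s. 0 \<le> g s) \<Longrightarrow> 0 \<le> conv f g s"
  by (simp add: conv_def infsum_nonneg)

lemma conv_mono_right:
  fixes f g :: "'g::group_add \<Rightarrow> real"
  assumes "f summable_on UNIV" "\<And>s. 0 \<le> f s" "\<And>s. \<bar>g s\<bar> \<le> c" "\<And>s. \<bar>h s\<bar> \<le> d" "\<And>s. g s \<le> h s"
  shows "conv f g s \<le> conv f h s"
  unfolding conv_def
proof (rule infsum_mono)
  have "(\<lambda>t. norm (f t)) summable_on UNIV" using assms by simp
  then show "(\<lambda>t. f t * g (- t + s)) summable_on UNIV" "(\<lambda>t. f t * h (- t + s)) summable_on UNIV"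
    using summable_on_conv(2)[of f g c s] summable_on_conv(2)[of f h d s] assms(3,4) by auto
qed (use assms in \<open>auto intro: mult_left_mono\<close>)

lemma lp_le_conv:
  fixes f g :: "'g::group_add \<Rightarrow> real"
  assumes f: "(\<lambda>t. norm (f t)) summable_on UNIV" and g: "lp_le q c g" and "1 \<le> q" "0 \<le> c"
  shows "lp_le q ((\<Sum>\<^sub>\<infinity>t. norm (f t)) * c) (conv f g)"
proof -
  have "lp_le q (\<Sum>\<^sub>\<infinity>t. norm (f t) * c) (\<lambda>s. \<Sum>\<^sub>\<infinity>t. f t * g (- t + s))"
    using assms lp_le_scale[OF lp_le_translate[OF g], of "f _"]
    by (intro lp_le_infsum) (auto intro: summable_on_cmult_left)
  then show ?thesis by (simp add: conv_def[abs_def] infsum_cmult_left')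
qed

text \<open>The law of \<open>t + u\<close> under \<open>f \<otimes> h\<close> is \<open>conv f h\<close>, so this bounds its \<open>\<phi>\<close>-moment.\<close>

lemma conv_weighted_bound:
  fixes f h \<phi> a b :: "'g::group_add \<Rightarrow> real"
  assumes f: "prob_measure f" and h: "prob_measure h" and \<phi>: "\<And>s. 0 \<le> \<phi> s"
    and ab: "\<And>t u. 0 < f t \<Longrightarrow> 0 < h u \<Longrightarrow> \<phi> (t + u) \<le> a t + b u"
    and a: "((\<lambda>t. f t * a t) has_sum A) UNIV" and b: "((\<lambda>u. h u * b u) has_sum B) UNIV"
  shows "(\<lambda>v. conv f h v * \<phi> v) summable_on UNIV" "(\<Sum>\<^sub>\<infinity>v. conv f h v * \<phi> v) \<le> A + B"
proof -
  have f0: "\<And>s. 0 \<le> f s" and f1: "(f has_sum 1) UNIV" and h0: "\<And>s. 0 \<le> h s" and h1: "(h has_sum 1) UNIV"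
    using f h by (auto simp: prob_measure_def)
  have hn: "(\<lambda>t. norm (h t)) summable_on UNIV" and fn: "(\<lambda>t. norm (f t)) summable_on UNIV"
    using f1 h1 f0 h0 by (auto simp: has_sum_iff)
  \<comment> \<open>The hypothesis \<open>ab\<close> speaks only about the supports of
    \<open>f\<close> and \<open>h\<close>; elsewhere the weight \<open>f t * h u\<close> is
    0.\<close>
  have le: "f t * h u * \<phi> (t + u) \<le> f t * h u * (a t + b u)" for t u
  proof (cases "f t = 0 \<or> h u = 0")
    case False
    then have "0 < f t" "0 < h u" using f0[of t] h0[of u] by auto
    then show ?thesis using ab by (auto intro!: mult_left_mono)
  qed auto
  have inner: "((\<lambda>u. f t * h u * (a t + b u)) has_sum f t * a t + f t * B) UNIV" for t
    using has_sum_add[OF has_sum_cmult_right[OF h1, of "f t * a t"] has_sum_cmult_right[OF b, of "f t"]]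
    by (simp add: algebra_simps)
  have outer: "((\<lambda>t. f t * a t + f t * B) has_sum A + B) UNIV"
    using has_sum_add[OF a has_sum_cmult_left[OF f1, of B]] by simp
  \<comment> \<open>\<open>a\<close> and \<open>b\<close> may be negative, but by \<open>le\<close>
    the weighted terms dominate nonnegative ones, so summing iteratively is legitimate.\<close>
  have K: "(\<lambda>(t, u). f t * h u * (a t + b u)) summable_on UNIV \<times> UNIV"
  proof (rule summable_on_SigmaI)
    show "(\<lambda>t. f t * a t + f t * B) summable_on UNIV" using outer by (auto simp: has_sum_iff)
  qed (use inner in \<open>auto intro: order_trans[OF _ le] simp: \<phi> f0 h0\<close>)
  have K': "((\<lambda>(t, u). f t * h u * (a t + b u)) has_sum A + B) (UNIV \<times> UNIV)"
    by (rule has_sum_SigmaI[OF _ outer K]) (simp add: inner)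
  have k: "(\<lambda>(t, u). f t * h u * \<phi> (t + u)) summable_on UNIV"
    by (rule summable_on_comparison_test[of "\<lambda>(t, u). f t * h u * (a t + b u)"])
       (use K le in \<open>auto simp: \<phi> f0 h0\<close>)
  have "((\<lambda>v. conv f h v * \<phi> v) has_sum (\<Sum>\<^sub>\<infinity>(t, u). f t * h u * \<phi> (t + u))) UNIV"
    by (rule conv_change_of_variables[OF has_sum_infsum[OF k] summable_on_conv(2)[OF fn norm_le_infsum_norm[OF hn]]])
  moreover have "(\<Sum>\<^sub>\<infinity>(t, u). f t * h u * \<phi> (t + u)) \<le> A + B"
    by (rule has_sum_mono[OF has_sum_infsum[OF k]]) (use K' le in auto)
  ultimately show "(\<lambda>v. conv f h v * \<phi> v) summable_on UNIV" "(\<Sum>\<^sub>\<infinity>v. conv f h v * \<phi> v) \<le> A + B"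
    by (auto simp: has_sum_iff)
qed

lemma prob_measure_conv:
  fixes f h :: "'g::group_add \<Rightarrow> real"
  assumes f: "prob_measure f" and h: "prob_measure h"
  shows "prob_measure (conv f h)"
proof -
  have f0: "\<And>s. 0 \<le> f s" and f1: "(f has_sum 1) UNIV" and h0: "\<And>s. 0 \<le> h s" and h1: "(h has_sum 1) UNIV"
    using f h by (auto simp: prob_measure_def)
  have hn: "(\<lambda>t. norm (h t)) summable_on UNIV" and fn: "(\<lambda>t. norm (f t)) summable_on UNIV"
    using f1 h1 f0 h0 by (auto simp: has_sum_iff)
  have "((\<lambda>(t, u). f t * h u) has_sum 1) (UNIV \<times> UNIV)"
  proof (rule has_sum_SigmaI[OF _ f1])
    show "((\<lambda>y. case (x, y) of (t, u) \<Rightarrow> f t * h u) has_sum f x) UNIV" for x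
      using has_sum_cmult_right[OF h1, of "f x"] by simp
    show "(\<lambda>(t, u). f t * h u) summable_on UNIV \<times> UNIV"
      using summable_on_product_mult[of f h] f1 h1 f0 h0 by (auto simp: has_sum_iff)
  qed
  then have "((\<lambda>v. conv f h v * 1) has_sum 1) UNIV"
    by (intro conv_change_of_variables summable_on_conv(2)[OF fn norm_le_infsum_norm[OF hn]]) simp
  then show ?thesis by (simp add: prob_measure_def conv_nonneg f0 h0)
qed

section \<open>Growth of convolution powers and the spectral radius\<close>

lemma in_lp_lp_le: "in_lp q g \<Longrightarrow> 0 < q \<Longrightarrow> lp_le q (lp_norm q g) (\<lambda>s. norm (g s))"
  by (simp add: lp_le_iff_lp_norm lp_norm_nonneg)

lemma lp_le_norm_diff:
  fixes g h :: "'g \<Rightarrow> complex"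
  assumes "lp_le q a (\<lambda>s. norm (g s))" "lp_le q b (\<lambda>s. norm (h s))" "1 \<le> q" "0 \<le> a" "0 \<le> b"
  shows "lp_le q (a + b) (\<lambda>s. norm (g s - h s))"
  by (rule lp_le_mono[OF lp_le_add[OF assms(1,2)]]) (use assms in \<open>auto intro: norm_triangle_ineq4\<close>)

text \<open>An operator norm bound tested on nonnegative functions only. For a nonnegative kernel
  this loses nothing and keeps pointwise comparison available.\<close>

definition op_le :: "real \<Rightarrow> real \<Rightarrow> ('g::group_add \<Rightarrow> real) \<Rightarrow> bool" where
  "op_le q K f \<longleftrightarrow> (\<forall>g c. (\<forall>s. 0 \<le> g s) \<longrightarrow> 0 \<le> c \<longrightarrow> lp_le q c g \<longrightarrow> lp_le q (K * c) (conv f g))"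

lemma op_leD:
  "op_le q K f \<Longrightarrow> (\<And>s. 0 \<le> g s) \<Longrightarrow> 0 \<le> c \<Longrightarrow> lp_le q c g \<Longrightarrow> lp_le q (K * c) (conv f g)"
  by (simp add: op_le_def)

lemma op_le_mono:
  fixes f :: "'g::group_add \<Rightarrow> real"
  assumes "op_le q K f" "0 < q" "0 \<le> K" "K \<le> K'"
  shows "op_le q K' f"
  unfolding op_le_def
proof (intro allI impI)
  fix g :: "'g \<Rightarrow> real" and c assume g: "\<forall>s. 0 \<le> g s" "0 \<le> c" "lp_le q c g"
  have "lp_le q (K * c) (conv f g)" using g by (intro op_leD[OF assms(1)]) auto
  then show "lp_le q (K' * c) (conv f g)"
    by (rule lp_le_mono) (use assms(2-4) g(2) in \<open>auto intro: mult_right_mono\<close>)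
qed

text \<open>Pointwise domination of \<open>conv f g\<close> by the convolution of the absolute
  values carries the bound from nonnegative to complex arguments.\<close>

lemma lp_le_conv_complex:
  fixes g :: "'g::group_add \<Rightarrow> complex"
  assumes f: "(\<lambda>t. norm (f t)) summable_on UNIV" and op: "op_le q K (\<lambda>t. norm (f t))" and "0 \<le> K"
    and g: "lp_le q c (\<lambda>s. norm (g s))" and "0 \<le> c" "0 < q"
  shows "lp_le q (K * c) (\<lambda>s. norm (conv f g s))"
proof (rule lp_le_mono[OF op_leD[OF op _ _ g]])
  fix s
  have "norm (g s) \<le> c" for s using lp_le_pointwise[OF g assms(6,5), of s] by simp
  from norm_conv_le[OF f this] have "norm (conv f g s) \<le> conv (\<lambda>t. norm (f t)) (\<lambda>s. norm (g s)) s" .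
  then show "\<bar>norm (conv f g s)\<bar> \<le> \<bar>conv (\<lambda>t. norm (f t)) (\<lambda>s. norm (g s)) s\<bar>" by simp
qed (use assms(3,5,6) in auto)

lemma op_le_Young:
  assumes "(\<lambda>t. norm (f t)) summable_on UNIV" "1 \<le> q"
  shows "op_le q (\<Sum>\<^sub>\<infinity>t. norm (f t)) f"
  unfolding op_le_def using lp_le_conv[OF assms(1) _ assms(2)] by blast

lemma lp_le_conv_l1:
  fixes g :: "'g::group_add \<Rightarrow> complex"
  assumes "in_l1 f" "1 \<le> q" "lp_le q c (\<lambda>s. norm (g s))" "0 \<le> c"
  shows "lp_le q ((\<Sum>\<^sub>\<infinity>t. norm (f t)) * c) (\<lambda>s. norm (conv f g s))"
proof (rule lp_le_conv_complex[OF _ _ _ assms(3)])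
  show "op_le q (\<Sum>\<^sub>\<infinity>t. norm (f t)) (\<lambda>t. norm (f t))"
    using op_le_Young[of "\<lambda>t. norm (f t)" q] assms by (simp add: in_l1_def)
qed (use assms in \<open>auto simp: in_l1_def infsum_nonneg\<close>)

text \<open>An element of \<open>PF q\<close> is within distance 1 of some convolution operator,
  which Young's inequality bounds by the l^1 norm \<open>F\<close>.\<close>

lemma PF_bounded:
  fixes B :: "('g::group_add \<Rightarrow> complex) \<Rightarrow> 'g \<Rightarrow> complex"
  assumes B: "B \<in> PF q" and q: "1 \<le> q"
  obtains M where "0 < M" "\<And>g. in_lp q g \<Longrightarrow> lp_norm q (B g) \<le> M * lp_norm q g"
proof -
  from B obtain f where f: "in_l1 f"
    and le: "\<And>g. in_lp q g \<Longrightarrow> lp_norm q (\<lambda>s. B g s - conv f g s) \<le> 1 * lp_norm q g"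
    unfolding PF_def by (auto elim!: allE[of _ "1::real"])
  define F where "F = (\<Sum>\<^sub>\<infinity>t. norm (f t))"
  have F: "F \<ge> 0" by (simp add: F_def infsum_nonneg)
  show thesis
  proof (rule that[of "1 + F"])
    show "0 < 1 + F" using F by simp
    fix g :: "'g \<Rightarrow> complex" assume g: "in_lp q g"
    define c where "c = lp_norm q g"
    have c: "c \<ge> 0" by (simp add: c_def lp_norm_nonneg)
    have Bg: "in_lp q (B g)" using B g by (simp add: PF_def)
    have fg: "lp_le q (F * c) (\<lambda>s. norm (conv f g s))"
      unfolding F_def by (rule lp_le_conv_l1[OF f q _ c]) (use in_lp_lp_le[OF g] q in \<open>simp add: c_def\<close>)
    \<comment> \<open>This crude bound only shows that the difference lies in l^q; without that, the
      estimate \<open>le\<close> on its \<open>lp_norm\<close> would carry no information.\<close>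
    have "lp_le q (lp_norm q (B g) + F * c) (\<lambda>s. norm (B g s - conv f g s))"
      using in_lp_lp_le[OF Bg] fg q F c by (intro lp_le_norm_diff) (auto simp: lp_norm_nonneg)
    then have "in_lp q (\<lambda>s. B g s - conv f g s)"
      using q F c by (subst (asm) lp_le_iff_lp_norm) (auto simp: lp_norm_nonneg)
    then have "lp_le q c (\<lambda>s. norm (B g s - conv f g s))"
      using le[OF g] q c by (subst lp_le_iff_lp_norm) (auto simp: c_def)
    from lp_le_add[OF this fg q c] have "lp_le q (c + F * c) (\<lambda>s. norm (B g s - conv f g s) + norm (conv f g s))"
      using F c by simp
    then have "lp_le q (c + F * c) (\<lambda>s. norm (B g s))"
    proof (rule lp_le_mono)
      show "\<bar>norm (B g s)\<bar> \<le> \<bar>norm (B g s - conv f g s) + norm (conv f g s)\<bar>" for s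
        using norm_triangle_ineq[of "B g s - conv f g s" "conv f g s"] by simp
    qed (use q F c in auto)
    then show "lp_norm q (B g) \<le> (1 + F) * lp_norm q g"
      using q F c by (subst (asm) lp_le_iff_lp_norm) (auto simp: c_def algebra_simps)
  qed
qed

section \<open>Convolution powers of one probability measure and their growth rates\<close>

locale random_walk =
  fixes \<mu> :: "'g::group_add \<Rightarrow> real"
  assumes prob: "prob_measure \<mu>"
begin

abbreviation m :: "nat \<Rightarrow> 'g \<Rightarrow> real" where "m \<equiv> conv_pow \<mu>"

abbreviation mc :: "nat \<Rightarrow> 'g \<Rightarrow> complex" where "mc n \<equiv> \<lambda>s. complex_of_real (m n s)"

abbreviation \<mu>c :: "'g \<Rightarrow> complex" where "\<mu>c \<equiv> \<lambda>s. complex_of_real (\<mu> s)"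

lemma prob_m: "prob_measure (m n)"
proof (induction n)
  case 0
  have "((delta :: 'g \<Rightarrow> real) has_sum 1) UNIV"
    by (rule has_sum_finite_neutralI[of "{0}"]) (auto simp: delta_def)
  moreover have "0 \<le> (delta s :: real)" for s :: 'g by (simp add: delta_def)
  ultimately show ?case by (simp add: prob_measure_def)
qed (simp add: prob_measure_conv prob)

lemma m_nonneg [simp]: "0 \<le> m n s"
  using prob_m by (simp add: prob_measure_def)

lemma has_sum_m: "(m n has_sum 1) UNIV"
  using prob_m by (simp add: prob_measure_def)

lemma summable_m [simp]: "m n summable_on UNIV"
  using has_sum_m by (auto simp: has_sum_iff)

lemma infsum_m [simp]: "(\<Sum>\<^sub>\<infinity>s. m n s) = 1"
  using has_sum_m by (auto simp: has_sum_iff)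

lemma m_1: "m (Suc 0) = \<mu>"
  by (simp add: conv_delta_right)

text \<open>Induction on \<open>j\<close> by associativity. The inner convolution keeps the bound
  \<open>c\<close> because \<open>m k\<close> has total mass 1.\<close>

lemma conv_m_m:
  fixes g :: "'g \<Rightarrow> real"
  assumes "\<And>s. \<bar>g s\<bar> \<le> c"
  shows "conv (m j) (conv (m k) g) = conv (m (j + k)) g"
proof (induction j)
  case 0
  show ?case by (simp add: conv_delta_left)
next
  case (Suc j)
  have l1: "(\<lambda>t. norm (m n t)) summable_on UNIV" for n by simp
  have \<mu>: "(\<lambda>t. norm (\<mu> t)) summable_on UNIV" using l1[of "Suc 0"] by (simp only: m_1)
  have b: "norm (conv (m k) g s) \<le> c" for s
  proof -
    have sum: "(\<lambda>t. norm (m k t * g (- t + s))) summable_on UNIV"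
      by (rule summable_on_conv(1)[OF l1]) (use assms in simp)
    then have "norm (conv (m k) g s) \<le> (\<Sum>\<^sub>\<infinity>t. norm (m k t * g (- t + s)))"
      unfolding conv_def by (rule norm_infsum_bound)
    also have "\<dots> \<le> (\<Sum>\<^sub>\<infinity>t. m k t * c)"
      using sum summable_on_cmult_left[OF summable_m, of k c]
      by (rule infsum_mono) (simp add: abs_mult mult_left_mono assms)
    also have "\<dots> = c" by (simp add: infsum_cmult_left')
    finally show ?thesis .
  qed
  have "conv (m (Suc j)) (conv (m k) g) = conv \<mu> (conv (m j) (conv (m k) g))"
    using conv_assoc[OF \<mu> l1, where g = "conv (m k) g", OF b, of j] by simp
  also have "\<dots> = conv \<mu> (conv (m (j + k)) g)" using Suc by simp
  also have "\<dots> = conv (m (Suc j + k)) g"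
    using conv_assoc[OF \<mu> l1, where g = g, of c "j + k"] assms by simp
  finally show ?case .
qed

lemma m_add: "m (j + k) = conv (m j) (m k)"
proof -
  have "conv (m j) (conv (m k) delta) = conv (m (j + k)) delta"
    by (rule conv_m_m[of _ 1]) (auto simp: delta_def)
  then show ?thesis by (simp add: conv_delta_right)
qed

lemma conv_mc_mc:
  assumes "\<And>s. norm (g s) \<le> c"
  shows "conv (mc j) (conv (mc k) g) = conv (mc (j + k)) g"
proof -
  have "mc (j + k) = conv (mc j) (mc k)" by (simp add: m_add conv_of_real fun_eq_iff)
  moreover have "conv (conv (mc j) (mc k)) g = conv (mc j) (conv (mc k) g)"
    by (rule conv_assoc) (use assms in simp_all)
  ultimately show ?thesis by (simp only:)
qed

lemma norm_conv_mc_le: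
  assumes "\<And>s. norm (g s) \<le> c"
  shows "norm (conv (mc k) g s) \<le> c"
proof -
  have sum: "(\<lambda>t. norm (mc k t * g (- t + s))) summable_on UNIV"
    by (rule summable_on_conv(1)[of "mc k"]) (use assms in simp_all)
  then have "norm (conv (mc k) g s) \<le> (\<Sum>\<^sub>\<infinity>t. norm (mc k t * g (- t + s)))"
    unfolding conv_def by (rule norm_infsum_bound)
  also have "\<dots> \<le> (\<Sum>\<^sub>\<infinity>t. m k t * c)"
    using sum summable_on_cmult_left[OF summable_m, of k c]
    by (rule infsum_mono) (simp add: norm_mult mult_left_mono assms)
  also have "\<dots> = c" by (simp add: infsum_cmult_left')
  finally show ?thesis .
qed

text \<open>The infimum of these \<open>t\<close> is the limit in Gelfand's spectral radius formula
  for the operators given by \<open>m k\<close>.\<close>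

definition growth :: "real \<Rightarrow> real \<Rightarrow> bool" where
  "growth q t \<longleftrightarrow> 0 < t \<and> (\<exists>K\<ge>0. \<forall>k. op_le q (K * t ^ k) (m k))"

lemma op_le_m: "1 \<le> q \<Longrightarrow> op_le q 1 (m k)"
  using op_le_Young[of "m k" q] by simp

lemma growth_one: "1 \<le> q \<Longrightarrow> growth q 1"
  by (auto simp: growth_def op_le_m intro!: exI[of _ 1])

lemma op_le_add:
  assumes "op_le q A (m j)" "op_le q B (m k)" "0 < q" "0 \<le> B"
  shows "op_le q (A * B) (m (j + k))"
  unfolding op_le_def
proof (intro allI impI)
  fix g :: "'g \<Rightarrow> real" and c assume g: "\<forall>s. 0 \<le> g s" "0 \<le> c" "lp_le q c g"
  have "lp_le q (A * (B * c)) (conv (m j) (conv (m k) g))"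
    using assms g by (intro op_leD conv_nonneg) auto
  moreover have "conv (m j) (conv (m k) g) = conv (m (j + k)) g"
    by (rule conv_m_m[of _ c]) (use lp_le_pointwise[OF g(3)] g assms in auto)
  ultimately show "lp_le q (A * B * c) (conv (m (j + k)) g)" by (simp add: mult.assoc)
qed

text \<open>A bound on one power suffices: split \<open>k\<close> into a multiple of
  \<open>n\<close>, handled by submultiplicativity, and a remainder \<open>b < n\<close>, handled by
  norm at most 1.\<close>

lemma growth_if_op_le:
  assumes op: "op_le q (s ^ n) (m n)" and "0 < n" and s: "0 < s" and q: "1 \<le> q"
  shows "growth q s"
proof -
  \<comment> \<open>\<open>R * s \<ge> 1\<close> pays for the missing factor \<open>s ^ b\<close>,
    and \<open>R \<ge> 1\<close> bounds \<open>R ^ b\<close> by \<open>R ^ n\<close> uniformly in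
    \<open>k\<close>.\<close>
  define R where "R = max 1 (1 / s)"
  have "op_le q (R ^ n * s ^ k) (m k)" for k
  proof -
    have *: "op_le q (s ^ (n * a)) (m (n * a))" for a
    proof (induction a)
      case (Suc a)
      from op_le_add[OF op Suc.IH] s q show ?case by (simp add: power_add)
    qed (use op_le_m[OF q, of 0] in simp)
    define a where "a = k div n"
    define b where "b = k mod n"
    have k: "k = b + n * a" by (simp add: a_def b_def)
    have "op_le q (1 * s ^ (n * a)) (m (b + n * a))"
      using * op_le_m[OF q] s q by (intro op_le_add) auto
    moreover have "1 * s ^ (n * a) \<le> R ^ n * s ^ k"
    proof -
      have "1 \<le> (R * s) ^ b" using s by (intro one_le_power) (auto simp: R_def field_simps max_def)
      then have "1 * s ^ (n * a) \<le> (R * s) ^ b * s ^ (n * a)" using s by (intro mult_right_mono) auto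
      also have "\<dots> = R ^ b * s ^ k" by (simp add: k power_add power_mult_distrib)
      also have "\<dots> \<le> R ^ n * s ^ k"
        using s \<open>0 < n\<close> by (intro mult_right_mono power_increasing) (auto simp: R_def b_def intro: less_imp_le)
      finally show ?thesis .
    qed
    ultimately show ?thesis unfolding k using s q by (elim op_le_mono) (auto simp flip: k)
  qed
  then show ?thesis using s by (auto simp: growth_def R_def intro!: exI[of _ "R ^ n"])
qed

end

section \<open>The Neumann series above the growth rate\<close>

lemma infsum_tail_tendsto_0:
  fixes f :: "nat \<Rightarrow> real"
  assumes "f summable_on UNIV"
  shows "(\<lambda>N. \<Sum>\<^sub>\<infinity>k\<in>{N..}. f k) \<longlonglongrightarrow> 0"
proof -
  have un: "{..<N} \<inter> {N..} = {}" "{..<N} \<union> {N..} = UNIV" for N :: nat by auto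
  have "(\<Sum>\<^sub>\<infinity>k\<in>{N..}. f k) = (\<Sum>\<^sub>\<infinity>k. f k) - (\<Sum>k<N. f k)" for N
    using infsum_Un_disjoint[of f "{..<N}" "{N..}"] summable_on_subset[OF assms, of "{N..}"]
    by (simp add: un)
  moreover have "(\<lambda>N. (\<Sum>\<^sub>\<infinity>k. f k) - (\<Sum>k<N. f k)) \<longlonglongrightarrow> (\<Sum>\<^sub>\<infinity>k. f k) - (\<Sum>\<^sub>\<infinity>k. f k)"
    using has_sum_imp_sums[OF has_sum_infsum[OF assms]] by (intro tendsto_diff) (auto simp: sums_def)
  ultimately show ?thesis by simp
qed

context random_walk
begin

lemma \<mu>_nonneg [simp]: "0 \<le> \<mu> s"
  using m_nonneg[of "Suc 0" s] by (simp only: m_1)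

lemma summable_\<mu> [simp]: "\<mu> summable_on UNIV"
  using summable_m[of "Suc 0"] by (simp only: m_1)

lemma op_le_mc: "op_le q K (m k) \<Longrightarrow> op_le q K (\<lambda>t. norm (mc k t))"
  by simp

text \<open>The Neumann series inverts \<open>z\<close> minus the operator. Its terms decay
  geometrically with ratio \<open>t / norm z\<close>, so it is an operator-norm limit of
  convolutions by l^1 functions and lies in \<open>PF q\<close>.\<close>

lemma not_in_PF_spectrum:
  assumes gr: "growth q t" and z: "t < norm z" and q: "1 \<le> q"
  shows "z \<notin> PF_spectrum q \<mu>c"
proof -
  from gr obtain K where t: "0 < t" and K: "0 \<le> K" and op: "\<And>k. op_le q (K * t ^ k) (m k)"
    by (auto simp: growth_def)
  have z0: "z \<noteq> 0" "0 < norm z" using z t by auto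
  \<comment> \<open>\<open>a k\<close> are the coefficients of the series, \<open>d k\<close> bounds
    the operator norm of its \<open>k\<close>-th term, and \<open>D N\<close> that of the tail from
    \<open>N\<close> on.\<close>
  define a :: "nat \<Rightarrow> complex" where "a k = inverse z ^ Suc k" for k
  define d where "d k = norm (a k) * (K * t ^ k)" for k
  define D where "D N = (\<Sum>\<^sub>\<infinity>k\<in>{N..}. d k)" for N
  define B where "B g s = (\<Sum>\<^sub>\<infinity>k. a k * conv (mc k) g s)" for g s
  define f where "f N s = (\<Sum>k<N. a k * mc k s)" for N s
  have un: "{..<N} \<inter> {N..} = {}" "{..<N} \<union> {N..} = UNIV" for N :: nat by auto
  have d_eq: "d k = K / norm z * (t / norm z) ^ k" for k
    by (simp add: d_def a_def norm_power norm_mult norm_inverse power_mult_distrib power_inverse divide_inverse mult_ac)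
  have d_nonneg: "0 \<le> d k" for k using K t by (simp add: d_def)
  have d: "d summable_on UNIV"
  proof -
    have "summable (\<lambda>k. K / norm z * (t / norm z) ^ k)"
      using z t z0 by (intro summable_mult summable_geometric) auto
    then have "summable d" by (simp add: d_eq[abs_def])
    then show ?thesis by (subst summable_on_UNIV_nonneg_real_iff) (auto simp: d_nonneg)
  qed
  have D0: "D \<longlonglongrightarrow> 0" unfolding D_def by (rule infsum_tail_tendsto_0[OF d])
  have D_nonneg: "0 \<le> D N" for N unfolding D_def by (intro infsum_nonneg d_nonneg)
  have f: "in_l1 (f N)" for N
  proof -
    have "(\<lambda>s. norm (a k * mc k s)) summable_on UNIV" for k
      by (simp add: norm_mult summable_on_cmult_right)
    then have "(\<lambda>s. \<Sum>k<N. norm (a k * mc k s)) summable_on UNIV"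
      using has_sum_sum[of "{..<N}" "\<lambda>k s. norm (a k * mc k s)", OF has_sum_infsum]
      by (auto simp: has_sum_iff)
    then show ?thesis unfolding in_l1_def f_def
      by (rule Infinite_Sum.abs_summable_on_comparison_test') (rule norm_sum)
  qed
  have conv_f: "conv (f N) g s = (\<Sum>k<N. a k * conv (mc k) g s)"
    if g: "\<And>s. norm (g s) \<le> c" for N g s c
    unfolding f_def using conv_sum_left[of "{..<N}" "\<lambda>k s. a k * mc k s", OF _ g]
    by (simp add: norm_mult summable_on_cmult_right conv_scale_left)
  have u: "lp_le q (d k * c) (\<lambda>s. norm (a k * conv (mc k) g s))"
    if g: "lp_le q c (\<lambda>s. norm (g s))" and c: "0 \<le> c" for k g c
  proof -
    have "lp_le q (K * t ^ k * c) (\<lambda>s. norm (conv (mc k) g s))"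
      using K t q c by (intro lp_le_conv_complex op_le_mc op g) auto
    from lp_le_scale[OF this, of "norm (a k)"] K t c show ?thesis
      by (simp add: d_def norm_mult mult.assoc)
  qed
  have term_sum: "((\<lambda>k. a k * conv (mc k) g s) has_sum B g s) UNIV"
    "(\<lambda>k. norm (a k * conv (mc k) g s)) summable_on UNIV"
    if g: "lp_le q c (\<lambda>s. norm (g s))" and c: "0 \<le> c" for g c s
  proof -
    have "norm (a k * conv (mc k) g s) \<le> d k * c" for k
      using lp_le_pointwise[OF u[OF g c], of k s] q c d_nonneg[of k] by simp
    with summable_on_cmult_left[OF d, of c]
    show *: "(\<lambda>k. norm (a k * conv (mc k) g s)) summable_on UNIV"
      by (rule Infinite_Sum.abs_summable_on_comparison_test')
    show "((\<lambda>k. a k * conv (mc k) g s) has_sum B g s) UNIV"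
      unfolding B_def by (rule has_sum_infsum) (rule abs_summable_summable[OF *])
  qed
  have tail: "lp_le q (D N * c) (\<lambda>s. norm (B g s - conv (f N) g s))"
    if g: "lp_le q c (\<lambda>s. norm (g s))" and c: "0 \<le> c" for N g c
  proof -
    have b: "norm (g s) \<le> c" for s using lp_le_pointwise[OF g] q c by simp
    have "lp_le q (\<Sum>\<^sub>\<infinity>k\<in>{N..}. d k * c) (\<lambda>s. \<Sum>\<^sub>\<infinity>k\<in>{N..}. norm (a k * conv (mc k) g s))"
      using q c d_nonneg by (intro lp_le_infsum u g summable_on_cmult_left summable_on_subset[OF d]) auto
    then have "lp_le q (D N * c) (\<lambda>s. \<Sum>\<^sub>\<infinity>k\<in>{N..}. norm (a k * conv (mc k) g s))"
      by (simp add: infsum_cmult_left' D_def)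
    then show ?thesis
    proof (rule lp_le_mono)
      fix s
      have 1: "(\<lambda>k. norm (a k * conv (mc k) g s)) summable_on {N..}"
        using term_sum(2)[OF g c] by (rule summable_on_subset) simp
      have "B g s = (\<Sum>k<N. a k * conv (mc k) g s) + (\<Sum>\<^sub>\<infinity>k\<in>{N..}. a k * conv (mc k) g s)"
        unfolding B_def
        using infsum_Un_disjoint[of "\<lambda>k. a k * conv (mc k) g s" "{..<N}" "{N..}"] abs_summable_summable[OF 1]
        by (simp add: un)
      then have "norm (B g s - conv (f N) g s) = norm (\<Sum>\<^sub>\<infinity>k\<in>{N..}. a k * conv (mc k) g s)"
        by (simp add: conv_f[OF b])
      also have "\<dots> \<le> (\<Sum>\<^sub>\<infinity>k\<in>{N..}. norm (a k * conv (mc k) g s))"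
        by (rule norm_infsum_bound[OF 1])
      finally show "\<bar>norm (B g s - conv (f N) g s)\<bar> \<le> \<bar>\<Sum>\<^sub>\<infinity>k\<in>{N..}. norm (a k * conv (mc k) g s)\<bar>" by simp
    qed (use q c D_nonneg in auto)
  qed
  have in_lp_B: "in_lp q (B g)" if g: "in_lp q g" for g
  proof -
    \<comment> \<open>At \<open>N = 0\<close> the approximant is zero, so the tail is all of
      \<open>B g\<close>.\<close>
    have "lp_le q (D 0 * lp_norm q g) (\<lambda>s. norm (B g s - conv (f 0) g s))"
      using q by (intro tail in_lp_lp_le g lp_norm_nonneg) auto
    moreover have "conv (f 0) g s = 0" for s by (simp add: conv_def f_def)
    ultimately show ?thesis using q D_nonneg by (simp add: lp_le_iff_lp_norm lp_norm_nonneg)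
  qed
  have "B \<in> PF q"
    unfolding PF_def
  proof (intro CollectI conjI allI impI)
    fix \<epsilon> :: real assume "0 < \<epsilon>"
    with D0 have "\<forall>\<^sub>F N in sequentially. D N < \<epsilon>" by (rule order_tendstoD)
    then obtain N where N: "D N < \<epsilon>" by (auto simp: eventually_sequentially)
    have "lp_norm q (\<lambda>s. B g s - conv (f N) g s) \<le> \<epsilon> * lp_norm q g" if g: "in_lp q g" for g
    proof -
      have "lp_le q (D N * lp_norm q g) (\<lambda>s. norm (B g s - conv (f N) g s))"
        using q by (intro tail in_lp_lp_le g lp_norm_nonneg) auto
      then have "lp_norm q (\<lambda>s. B g s - conv (f N) g s) \<le> D N * lp_norm q g"
        using q D_nonneg by (simp add: lp_le_iff_lp_norm lp_norm_nonneg)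
      also have "\<dots> \<le> \<epsilon> * lp_norm q g" using N by (intro mult_right_mono lp_norm_nonneg) auto
      finally show ?thesis .
    qed
    with f show "\<exists>f. in_l1 f \<and> (\<forall>g. in_lp q g \<longrightarrow> lp_norm q (\<lambda>s. B g s - conv f g s) \<le> \<epsilon> * lp_norm q g)"
      by blast
  qed (rule in_lp_B)
  moreover have "B (\<lambda>s. z * g s - conv \<mu>c g s) = g \<and> (\<lambda>s. z * B g s - conv \<mu>c (B g) s) = g"
    if g: "in_lp q g" for g
  proof -
    define c where "c = lp_norm q g"
    have c: "0 \<le> c" by (simp add: c_def lp_norm_nonneg)
    have gc: "lp_le q c (\<lambda>s. norm (g s))" unfolding c_def using q by (intro in_lp_lp_le g) auto
    have b: "norm (g s) \<le> c" for s using lp_le_pointwise[OF gc] q c by simp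
    have b': "norm (conv (mc k) g s) \<le> c" for k s by (rule norm_conv_mc_le) (rule b)
    have \<mu>c: "\<mu>c = mc (Suc 0)" by (simp only: m_1)
    have comm: "conv (mc k) (conv \<mu>c g) = conv (mc (Suc k)) g" "conv \<mu>c (conv (mc k) g) = conv (mc (Suc k)) g" for k
      unfolding \<mu>c using conv_mc_mc[OF b] by (simp_all del: conv_pow.simps)
    have az: "a k * z = inverse z ^ k" for k using z0 by (simp add: a_def)
    \<comment> \<open>This is the term left over when the partial sums telescope in
      \<open>tele\<close>.\<close>
    have rem: "(\<lambda>N. inverse z ^ N * conv (mc N) g s) \<longlonglongrightarrow> 0" for s
    proof (rule Lim_null_comparison)
      have "lp_le q (K * t ^ N * c) (\<lambda>s. norm (conv (mc N) g s))" for N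
        using K t q c by (intro lp_le_conv_complex op_le_mc op gc) auto
      from lp_le_pointwise[OF this] have *: "norm (conv (mc N) g s) \<le> K * t ^ N * c" for N
        using q K t c by simp
      have "norm (inverse z ^ N * conv (mc N) g s) \<le> inverse (norm z) ^ N * (K * t ^ N * c)" for N
        using * by (simp add: norm_mult norm_power norm_inverse mult_left_mono)
      also have "inverse (norm z) ^ N * (K * t ^ N * c) = K * c * (t / norm z) ^ N" for N
        by (simp add: field_simps power_divide)
      finally show "\<forall>\<^sub>F N in sequentially. norm (inverse z ^ N * conv (mc N) g s) \<le> K * c * (t / norm z) ^ N"
        by simp
      show "(\<lambda>N. K * c * (t / norm z) ^ N) \<longlonglongrightarrow> 0"
        using z t z0 by (intro tendsto_mult_right_zero LIMSEQ_power_zero) auto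
    qed
    have tele: "(\<Sum>k<N. a k * (z * conv (mc k) g s - conv (mc (Suc k)) g s)) =
        g s - inverse z ^ N * conv (mc N) g s" for N s
    proof (induction N)
      case 0
      have "conv (mc 0) g = g" using conv_delta_left[of g] by (simp add: delta_def[abs_def] if_distrib cong: if_cong)
      then show ?case by simp
    next
      case (Suc N)
      have "a N * (z * conv (mc N) g s - conv (mc (Suc N)) g s) =
        inverse z ^ N * conv (mc N) g s - inverse z ^ Suc N * conv (mc (Suc N)) g s"
        using az[of N] by (simp add: right_diff_distrib a_def mult.assoc[symmetric] del: conv_pow.simps)
      with Suc show ?case by (simp del: conv_pow.simps)
    qed
    have lim: "(\<lambda>N. g s - inverse z ^ N * conv (mc N) g s) \<longlonglongrightarrow> g s" for s
      using tendsto_diff[OF tendsto_const rem[of s], of "g s"] by simp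
    define y where "y s = z * g s - conv \<mu>c g s" for s
    have conv_g: "lp_le q (1 * c) (\<lambda>s. norm (conv \<mu>c g s))"
      unfolding \<mu>c by (rule lp_le_conv_complex) (use op_le_m[OF q] q c gc in \<open>auto simp del: conv_pow.simps\<close>)
    have zg: "lp_le q (norm z * c) (\<lambda>s. norm (z * g s))"
      using lp_le_scale[OF gc c, of "norm z"] by (simp add: norm_mult)
    have y: "lp_le q (norm z * c + 1 * c) (\<lambda>s. norm (y s))"
      unfolding y_def using q c zg conv_g by (intro lp_le_norm_diff) auto
    have conv_y: "conv (mc k) y s = z * conv (mc k) g s - conv (mc (Suc k)) g s" for k s
    proof -
      have "conv (mc k) y s = conv (mc k) (\<lambda>s. z * g s) s - conv (mc k) (conv \<mu>c g) s"
        unfolding y_def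
      proof (rule conv_diff_right)
        show "norm (z * g s) \<le> norm z * c" for s by (simp add: norm_mult b mult_left_mono)
        show "norm (conv \<mu>c g s) \<le> c" for s unfolding \<mu>c by (rule b')
      qed simp
      then show ?thesis by (simp add: comm conv_scale_right del: conv_pow.simps)
    qed
    \<comment> \<open>Left inverse: the series for \<open>B y\<close> telescopes to \<open>g\<close>
      minus the remainder.\<close>
    have "B y s = g s" for s
    proof -
      have "(\<lambda>k. a k * conv (mc k) y s) sums B y s"
        by (rule has_sum_imp_sums, rule term_sum(1)[OF y]) (use c in auto)
      then have "(\<lambda>N. g s - inverse z ^ N * conv (mc N) g s) \<longlonglongrightarrow> B y s"
        by (simp add: sums_def conv_y tele del: conv_pow.simps)
      with lim[of s] show ?thesis by (metis LIMSEQ_unique)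
    qed
    \<comment> \<open>Right inverse: the identity holds up to the remainder for the partial sums,
      which converge to \<open>B g\<close> uniformly, and convolution by a probability measure does
      not increase the sup norm.\<close>
    moreover have "z * B g s - conv \<mu>c (B g) s = g s" for s
    proof -
      have BN: "norm (B g s - conv (f N) g s) \<le> D N * c" for N s
        using lp_le_pointwise[OF tail[OF gc c]] q c D_nonneg by simp
      have bf: "norm (conv (f N) g s) \<le> (\<Sum>k<N. norm (a k)) * c" for N s
        unfolding conv_f[OF b] sum_distrib_right
        by (rule order_trans[OF norm_sum], rule sum_mono) (simp add: norm_mult mult_left_mono b')
      have bB: "norm (B g s) \<le> D 0 * c + (\<Sum>k<0. norm (a k)) * c" for s
        using norm_triangle_le_diff[of "B g s - conv (f 0) g s" "- conv (f 0) g s"] BN[of s 0] bf[of 0 s]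
        by simp
      have l1: "(\<lambda>t. norm (\<mu>c t)) summable_on UNIV" by simp
      have eq: "z * conv (f N) g s - conv \<mu>c (conv (f N) g) s = g s - inverse z ^ N * conv (mc N) g s" for N
      proof -
        have "conv \<mu>c (conv (f N) g) s = (\<Sum>k<N. conv \<mu>c (\<lambda>s. a k * conv (mc k) g s) s)"
          unfolding conv_f[OF b]
          by (rule conv_sum_right[OF l1, of _ _ "\<lambda>k. norm (a k) * c"]) (simp add: norm_mult mult_left_mono b')
        also have "\<dots> = (\<Sum>k<N. a k * conv (mc (Suc k)) g s)"
          by (simp add: conv_scale_right comm del: conv_pow.simps)
        finally show ?thesis
          unfolding tele[symmetric] conv_f[OF b]
          by (simp add: sum_distrib_left right_diff_distrib sum_subtractf mult.left_commute[of z] del: conv_pow.simps)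
      qed
      have "(\<lambda>N. (z * B g s - conv \<mu>c (B g) s) - (z * conv (f N) g s - conv \<mu>c (conv (f N) g) s)) \<longlonglongrightarrow> 0"
      proof (rule Lim_null_comparison)
        have "(z * B g s - conv \<mu>c (B g) s) - (z * conv (f N) g s - conv \<mu>c (conv (f N) g) s) =
           z * (B g s - conv (f N) g s) - conv \<mu>c (\<lambda>s. B g s - conv (f N) g s) s" for N
          by (subst conv_diff_right[OF l1 bB bf]) (simp add: algebra_simps)
        moreover have "norm (conv \<mu>c (\<lambda>s. B g s - conv (f N) g s) s) \<le> D N * c" for N
          unfolding \<mu>c by (rule norm_conv_mc_le) (rule BN)
        ultimately have "norm ((z * B g s - conv \<mu>c (B g) s) - (z * conv (f N) g s - conv \<mu>c (conv (f N) g) s))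
          \<le> norm z * (D N * c) + D N * c" for N
          using BN[of s N] by (auto intro!: order_trans[OF norm_triangle_ineq4] add_mono mult_left_mono simp: norm_mult)
        then show "\<forall>\<^sub>F N in sequentially. norm ((z * B g s - conv \<mu>c (B g) s) - (z * conv (f N) g s - conv \<mu>c (conv (f N) g) s))
          \<le> norm z * (D N * c) + D N * c" by simp
        show "(\<lambda>N. norm z * (D N * c) + D N * c) \<longlonglongrightarrow> 0"
          by (rule tendsto_eq_intros D0 refl)+ simp
      qed
      then have "(\<lambda>N. (z * B g s - conv \<mu>c (B g) s) - (g s - inverse z ^ N * conv (mc N) g s)) \<longlonglongrightarrow> 0"
        by (simp only: eq)
      from tendsto_add[OF this lim[of s]] show ?thesis by (simp add: LIMSEQ_const_iff)
    qed
    ultimately show ?thesis by (auto simp: y_def[abs_def])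
  qed
  ultimately show ?thesis by (auto simp: PF_spectrum_def)
qed

section \<open>Truncated Green functions (partial Neumann sums) and the positivity argument\<close>

definition green :: "real \<Rightarrow> nat \<Rightarrow> ('g \<Rightarrow> real) \<Rightarrow> 'g \<Rightarrow> real" where
  "green t N g s = (\<Sum>k<N. inverse t ^ Suc k * conv (m k) g s)"

lemma green_nonneg: "0 < t \<Longrightarrow> (\<And>s. 0 \<le> g s) \<Longrightarrow> 0 \<le> green t N g s"
  by (simp add: green_def sum_nonneg conv_nonneg)

lemma green_mono_N: "0 < t \<Longrightarrow> (\<And>s. 0 \<le> g s) \<Longrightarrow> N \<le> N' \<Longrightarrow> green t N g s \<le> green t N' g s"
  unfolding green_def by (intro sum_mono2) (auto intro!: mult_nonneg_nonneg conv_nonneg)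

lemma conv_m_le: "(\<And>s. \<bar>g s\<bar> \<le> c) \<Longrightarrow> \<bar>conv (m k) g s\<bar> \<le> c"
  using norm_conv_mc_le[of "\<lambda>s. complex_of_real (g s)" c k s] by (simp add: conv_of_real)

lemma lp_le_green:
  assumes "1 \<le> q" "0 < t" "\<And>s. 0 \<le> g s" "0 \<le> c" "lp_le q c g"
  shows "lp_le q (\<Sum>k<N. inverse t ^ Suc k * c) (green t N g)"
  unfolding green_def[abs_def]
proof (rule lp_le_sum)
  fix k
  have "lp_le q c (conv (m k) g)" using op_leD[OF op_le_m, of q g c k] assms by simp
  from lp_le_scale[OF this, of "inverse t ^ Suc k"] assms
  show "lp_le q (inverse t ^ Suc k * c) (\<lambda>s. inverse t ^ Suc k * conv (m k) g s)" by simp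
qed (use assms in auto)

text \<open>The sum telescopes. The truncation error stays explicit because it is estimated later at
  one suitable \<open>N\<close>.\<close>

lemma green_resolvent:
  assumes t: "0 < t" and g: "\<And>s. \<bar>g s\<bar> \<le> c"
  shows "t * green t N g s - conv \<mu> (green t N g) s = g s - inverse t ^ N * conv (m N) g s"
proof (induction N)
  case 0
  have "conv (m 0) g s = g s" by (simp add: conv_delta_left)
  then show ?case by (simp add: green_def conv_def[of \<mu>])
next
  case (Suc N)
  have c: "norm (conv (m k) g s) \<le> c" for k s using conv_m_le[OF g] by simp
  have l1: "(\<lambda>t. norm (\<mu> t)) summable_on UNIV" by simp
  have 1: "conv \<mu> (green t N g) s = (\<Sum>k<N. inverse t ^ Suc k * conv (m (Suc k)) g s)" for N
  proof -
    have "conv \<mu> (green t N g) s = (\<Sum>k<N. conv \<mu> (\<lambda>s. inverse t ^ Suc k * conv (m k) g s) s)"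
      unfolding green_def[abs_def]
      by (rule conv_sum_right[OF l1, of _ _ "\<lambda>k. inverse t ^ Suc k * c"])
         (use t c in \<open>simp add: abs_mult mult_left_mono\<close>)
    also have "\<dots> = (\<Sum>k<N. inverse t ^ Suc k * conv (m (Suc k)) g s)"
    proof (rule sum.cong)
      fix k
      have "conv \<mu> (conv (m k) g) = conv (m (Suc k)) g"
        using conv_m_m[OF g, of "Suc 0" k] by (simp only: m_1 plus_nat.add_Suc plus_nat.add_0)
      then show "conv \<mu> (\<lambda>s. inverse t ^ Suc k * conv (m k) g s) s = inverse t ^ Suc k * conv (m (Suc k)) g s"
        by (simp add: conv_scale_right)
    qed simp
    finally show ?thesis .
  qed
  have 2: "t * green t (Suc N) g s = t * green t N g s + inverse t ^ N * conv (m N) g s"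
    using t by (simp add: green_def distrib_left)
  show ?case using Suc unfolding 1 2 by (simp add: 1 del: conv_pow.simps)
qed

text \<open>If \<open>\<sigma> - \<lambda>\<^sub>q(\<mu>)\<close> has a bounded left inverse then, letting \<open>t\<close> decrease to \<open>\<sigma>\<close> and using that
  all terms are nonnegative, the partial sums of the Neumann series at \<open>\<sigma>\<close> itself are bounded.\<close>

lemma lp_le_green_Inf:
  fixes B :: "('g \<Rightarrow> complex) \<Rightarrow> 'g \<Rightarrow> complex"
  assumes q: "1 \<le> q" and \<sigma>: "0 < \<sigma>" and dense: "\<And>t. \<sigma> < t \<Longrightarrow> \<exists>\<tau>. growth q \<tau> \<and> \<tau> < t"
    and M: "0 < M" "\<And>g. in_lp q g \<Longrightarrow> lp_norm q (B g) \<le> M * lp_norm q g"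
    and B: "\<And>g. in_lp q g \<Longrightarrow> B (\<lambda>s. complex_of_real \<sigma> * g s - conv \<mu>c g s) = g"
    and g: "\<And>s. 0 \<le> g s" and c: "0 \<le> c" and gc: "lp_le q c g"
  shows "lp_le q (8 * M * c) (green \<sigma> N g)"
proof -
  \<comment> \<open>\<open>t\<close> is taken so close to \<open>\<sigma>\<close> that passing from
    \<open>t\<close> to \<open>\<sigma>\<close> in the first \<open>N\<close> terms costs at most a
    factor 2, and that \<open>M * (t - \<sigma>) \<le> 1 / 2\<close>.\<close>
  have "((\<lambda>t. (t / \<sigma>) ^ N) \<longlongrightarrow> (\<sigma> / \<sigma>) ^ N) (at_right \<sigma>)"
    using \<sigma> by (intro tendsto_intros) auto
  then have "\<forall>\<^sub>F t in at_right \<sigma>. (t / \<sigma>) ^ N < 2"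
    using \<sigma> by (intro order_tendstoD) auto
  moreover have "\<forall>\<^sub>F t in at_right \<sigma>. t < \<sigma> + 1 / (2 * M)"
    using M by (intro eventually_at_right_real[THEN eventually_mono]) auto
  moreover have "\<forall>\<^sub>F t in at_right \<sigma>. \<sigma> < t" by (simp add: eventually_at_right_less)
  ultimately have "\<forall>\<^sub>F t in at_right \<sigma>. (t / \<sigma>) ^ N < 2 \<and> t < \<sigma> + 1 / (2 * M) \<and> \<sigma> < t"
    by eventually_elim auto
  then obtain t where t: "(t / \<sigma>) ^ N < 2" "t < \<sigma> + 1 / (2 * M)" "\<sigma> < t"
    using eventually_happens'[OF trivial_limit_at_right_real] by blast
  have t0: "0 < t" using t \<sigma> by simp
  have Mt: "M * (t - \<sigma>) \<le> 1 / 2" using t M by (simp add: field_simps)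
  obtain \<tau> where \<tau>: "growth q \<tau>" "\<tau> < t" using dense t by blast
  then obtain K where K: "0 < \<tau>" "0 \<le> K" "\<And>k. op_le q (K * \<tau> ^ k) (m k)" by (auto simp: growth_def)
  have "(\<lambda>n. K * (\<tau> / t) ^ n) \<longlonglongrightarrow> 0"
    using K \<tau> t0 by (intro tendsto_mult_right_zero LIMSEQ_power_zero) auto
  then have "\<forall>\<^sub>F n in sequentially. K * (\<tau> / t) ^ n < 1" by (rule order_tendstoD) simp
  then obtain N0 where "\<And>n. N0 \<le> n \<Longrightarrow> K * (\<tau> / t) ^ n < 1" by (auto simp: eventually_sequentially)
  \<comment> \<open>The truncation is extended until the error term at \<open>t\<close> has norm at
    most that of \<open>g\<close>; a growth rate \<open>\<tau> < t\<close> makes this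
    possible.\<close>
  then obtain N' where N': "N \<le> N'" "K * (\<tau> / t) ^ N' \<le> 1"
    using le_cases[of N N0] by (metis less_imp_le order_refl)
  have gb: "\<bar>g s\<bar> \<le> c" for s using lp_le_pointwise[OF gc] q c by simp
  define h where "h = green t N' g"
  have h0: "0 \<le> h s" for s unfolding h_def by (rule green_nonneg[OF t0 g])
  define hc where "hc s = complex_of_real (h s)" for s
  \<comment> \<open>The bound used here depends on \<open>N'\<close> and is discarded; it only
    ensures that \<open>b\<close> is a genuine finite norm that can be absorbed later.\<close>
  have "in_lp q hc"
  proof -
    have "lp_le q (\<Sum>k<N'. inverse t ^ Suc k * c) (\<lambda>s. norm (hc s))"
      using lp_le_green[OF q t0 g c gc, of N'] h0 by (simp add: hc_def h_def)
    then show ?thesis using q t0 c by (subst (asm) lp_le_iff_lp_norm) (auto intro!: sum_nonneg)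
  qed
  define b where "b = lp_norm q hc"
  have b0: "0 \<le> b" by (simp add: b_def lp_norm_nonneg)
  have hb: "lp_le q b h" using in_lp_lp_le[OF \<open>in_lp q hc\<close>] q h0 by (simp add: hc_def b_def)
  define y where "y s = complex_of_real \<sigma> * hc s - conv \<mu>c hc s" for s
  \<comment> \<open>By \<open>green_resolvent\<close>, \<open>y\<close> is \<open>g\<close> minus
    the truncation error minus \<open>(t - \<sigma>) * h\<close>; the three parts contribute
    \<open>c\<close>, \<open>c\<close> and \<open>(t - \<sigma>) * b\<close>.\<close>
  have "lp_le q (2 * c + (t - \<sigma>) * b) (\<lambda>s. norm (y s))"
  proof (rule lp_le_mono)
    have "lp_le q (K * \<tau> ^ N' * c) (conv (m N') g)" by (rule op_leD[OF K(3) g c gc])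
    from lp_le_scale[OF this, of "inverse t ^ N'"]
    have "lp_le q (K * (\<tau> / t) ^ N' * c) (\<lambda>s. inverse t ^ N' * conv (m N') g s)"
      using K c t0 by (simp add: power_mult_distrib power_inverse divide_inverse mult_ac)
    then have "lp_le q c (\<lambda>s. inverse t ^ N' * conv (m N') g s)"
    proof (rule lp_le_mono)
      show "K * (\<tau> / t) ^ N' * c \<le> c" using mult_right_mono[OF N'(2) c] by simp
    qed (use q K c t0 in auto)
    from lp_le_add[OF gc this q c c]
    have "lp_le q (c + c) (\<lambda>s. g s + inverse t ^ N' * conv (m N') g s)" .
    moreover have "lp_le q ((t - \<sigma>) * b) (\<lambda>s. (t - \<sigma>) * h s)"
      using lp_le_scale[OF hb b0, of "t - \<sigma>"] t by simp
    ultimately show "lp_le q (2 * c + (t - \<sigma>) * b) (\<lambda>s. (g s + inverse t ^ N' * conv (m N') g s) + (t - \<sigma>) * h s)"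
      using lp_le_add[of q "c + c" "\<lambda>s. g s + inverse t ^ N' * conv (m N') g s" "(t - \<sigma>) * b" "\<lambda>s. (t - \<sigma>) * h s"]
        q c b0 t by simp
    fix s
    have "y s = complex_of_real (\<sigma> * h s - conv \<mu> h s)"
      by (simp add: y_def hc_def[abs_def] conv_of_real)
    also have "\<sigma> * h s - conv \<mu> h s = g s - inverse t ^ N' * conv (m N') g s - (t - \<sigma>) * h s"
      using green_resolvent[where t = t and N = N' and s = s and g = g and c = c, OF t0 gb] by (simp add: h_def algebra_simps)
    finally have "norm (y s) = \<bar>g s - inverse t ^ N' * conv (m N') g s - (t - \<sigma>) * h s\<bar>"
      by (simp only: norm_of_real)
    moreover have "0 \<le> inverse t ^ N' * conv (m N') g s" using t0 by (simp add: conv_nonneg g)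
    moreover have "0 \<le> (t - \<sigma>) * h s" using t h0 by simp
    ultimately show "\<bar>norm (y s)\<bar> \<le> \<bar>(g s + inverse t ^ N' * conv (m N') g s) + (t - \<sigma>) * h s\<bar>"
      using g[of s] by simp
  qed (use q c b0 t in auto)
  then have "in_lp q y" "lp_norm q y \<le> 2 * c + (t - \<sigma>) * b"
    using q c b0 t by (auto simp: lp_le_iff_lp_norm)
  \<comment> \<open>\<open>B\<close> maps \<open>y\<close> back to \<open>hc\<close>, so
    \<open>b\<close> is bounded by itself with coefficient at most 1/2 plus
    \<open>2 * M * c\<close>, and half of it can be absorbed.\<close>
  have "b \<le> M * lp_norm q y"
    using M(2)[OF \<open>in_lp q y\<close>] B[OF \<open>in_lp q hc\<close>] by (simp add: b_def y_def[abs_def])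
  also have "\<dots> \<le> M * (2 * c + (t - \<sigma>) * b)"
    using M \<open>lp_norm q y \<le> _\<close> by (intro mult_left_mono) auto
  also have "\<dots> = 2 * M * c + M * (t - \<sigma>) * b" by (simp add: algebra_simps)
  also have "\<dots> \<le> 2 * M * c + 1 / 2 * b" by (intro add_left_mono mult_right_mono Mt b0)
  finally have b4: "b \<le> 4 * M * c" by simp
  \<comment> \<open>The factor 2 for replacing \<open>t\<close> by \<open>\<sigma>\<close> turns
    \<open>4 * M * c\<close> into \<open>8 * M * c\<close>.\<close>
  from lp_le_scale[OF hb b0, of 2] have "lp_le q (2 * b) (\<lambda>s. 2 * h s)" by simp
  then show ?thesis
  proof (rule lp_le_mono)
    fix s
    have "green \<sigma> N g s \<le> 2 * green t N g s"
      unfolding green_def sum_distrib_left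
    proof (rule sum_mono)
      fix k assume k: "k \<in> {..<N}"
      have "(t / \<sigma>) ^ Suc k \<le> (t / \<sigma>) ^ N" using k t \<sigma> by (intro power_increasing) auto
      then have "(t / \<sigma>) ^ Suc k \<le> 2" using t by simp
      then have "inverse \<sigma> ^ Suc k \<le> 2 * inverse t ^ Suc k"
        using t0 \<sigma> by (simp add: power_divide power_inverse field_simps)
      from mult_right_mono[OF this, of "conv (m k) g s"]
      show "inverse \<sigma> ^ Suc k * conv (m k) g s \<le> 2 * (inverse t ^ Suc k * conv (m k) g s)"
        by (simp add: conv_nonneg g mult.assoc)
    qed
    also have "\<dots> \<le> 2 * h s" unfolding h_def using green_mono_N[where s = s and g = g, OF t0 g N'(1)] by simp
    finally show "\<bar>green \<sigma> N g s\<bar> \<le> \<bar>2 * h s\<bar>" using green_nonneg[where s = s and g = g and N = N, OF \<sigma> g] by simp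
  qed (use q b0 b4 in auto)
qed

text \<open>In the product of the two partial sums, the \<open>n + 1\<close> pairs with indices
  \<open>j\<close> and \<open>n - j\<close> all contribute the same multiple of \<open>m n\<close>;
  the other terms are nonnegative and are dropped.\<close>

lemma green_green_ge:
  assumes t: "0 < t" and g: "\<And>s. 0 \<le> g s" and gb: "\<And>s. \<bar>g s\<bar> \<le> c"
  shows "real (Suc n) * (inverse t ^ (n + 2) * conv (m n) g s) \<le> green t (Suc n) (green t (Suc n) g) s"
proof -
  have "real (Suc n) * (inverse t ^ (n + 2) * conv (m n) g s) = (\<Sum>j<Suc n. inverse t ^ (n + 2) * conv (m n) g s)"
    by simp
  also have "\<dots> \<le> (\<Sum>j<Suc n. inverse t ^ Suc j * conv (m j) (green t (Suc n) g) s)"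
  proof (rule sum_mono)
    fix j assume "j \<in> {..<Suc n}"
    then have j: "j \<le> n" by simp
    define a where "a = inverse t ^ Suc (n - j)"
    have a: "0 \<le> a" using t by (simp add: a_def)
    have "inverse t ^ (n + 2) * conv (m n) g s = inverse t ^ Suc j * (a * conv (m n) g s)"
      using j by (simp add: a_def power_add[symmetric] mult.assoc[symmetric] flip: power_Suc)
    also have "a * conv (m n) g s = conv (m j) (\<lambda>s. a * conv (m (n - j)) g s) s"
      using conv_m_m[OF gb, of j "n - j"] j by (simp add: conv_scale_right)
    also have "\<dots> \<le> conv (m j) (green t (Suc n) g) s"
    proof (rule conv_mono_right)
      show "\<bar>a * conv (m (n - j)) g s\<bar> \<le> a * c" for s
        using conv_m_le[OF gb] a by (simp add: abs_mult mult_left_mono)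
      show "\<bar>green t (Suc n) g s\<bar> \<le> (\<Sum>k<Suc n. inverse t ^ Suc k * c)" for s
        unfolding green_def
        by (rule order_trans[OF sum_abs], rule sum_mono)
           (use t conv_m_le[OF gb] in \<open>simp add: abs_mult mult_left_mono\<close>)
      show "a * conv (m (n - j)) g s \<le> green t (Suc n) g s" for s
        unfolding green_def a_def
        by (rule member_le_sum) (use t in \<open>auto simp: conv_nonneg g\<close>)
    qed auto
    finally show "inverse t ^ (n + 2) * conv (m n) g s \<le> inverse t ^ Suc j * conv (m j) (green t (Suc n) g) s"
      using t by (simp add: mult_left_mono)
  qed
  finally show ?thesis by (simp only: green_def)
qed

text \<open>As for any positive operator, the spectral radius itself lies in the spectrum. Otherwise
  the squared Neumann series, whose \<open>n\<close>-th term carries a factor \<open>n + 1\<close>, would stay bounded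
  at \<open>\<sigma>\<close>, which forces a growth rate below \<open>\<sigma>\<close>.\<close>

lemma Inf_growth_in_PF_spectrum:
  assumes q: "1 \<le> q" and x: "0 < x" "\<And>t. growth q t \<Longrightarrow> x \<le> t"
  shows "complex_of_real (Inf {t. growth q t}) \<in> PF_spectrum q \<mu>c" "x \<le> Inf {t. growth q t}"
proof -
  define \<sigma> where "\<sigma> = Inf {t. growth q t}"
  have ne: "{t. growth q t} \<noteq> {}" using growth_one[OF q] by auto
  have bdd: "bdd_below {t. growth q t}" using x by (auto intro!: bdd_belowI)
  show x\<sigma>: "x \<le> Inf {t. growth q t}" using ne x by (intro cInf_greatest) auto
  then have \<sigma>: "0 < \<sigma>" using x by (simp add: \<sigma>_def)
  have dense: "\<exists>\<tau>. growth q \<tau> \<and> \<tau> < t" if "\<sigma> < t" for t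
    using that cInf_less_iff[OF ne bdd] by (auto simp: \<sigma>_def)
  show "complex_of_real (Inf {t. growth q t}) \<in> PF_spectrum q \<mu>c"
  proof (rule ccontr)
    assume "\<not> ?thesis"
    then obtain B where BPF: "B \<in> PF q"
      and B: "\<And>g. in_lp q g \<Longrightarrow> B (\<lambda>s. complex_of_real \<sigma> * g s - conv \<mu>c g s) = g"
      by (auto simp: PF_spectrum_def \<sigma>_def)
    obtain M where M: "0 < M" "\<And>g. in_lp q g \<Longrightarrow> lp_norm q (B g) \<le> M * lp_norm q g"
      using PF_bounded[OF BPF q] by blast
    note green = lp_le_green_Inf[OF q \<sigma> dense M B]
    \<comment> \<open>Two applications of \<open>green\<close> give \<open>64 * M\<^sup>2\<close>;
      the exponent \<open>n + 2\<close> of the double sum leaves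
      \<open>\<sigma>\<^sup>2\<close>.\<close>
    have op: "op_le q (64 * M\<^sup>2 * \<sigma>\<^sup>2 / Suc n * \<sigma> ^ n) (m n)" for n
      unfolding op_le_def
    proof (intro allI impI)
      fix g :: "'g \<Rightarrow> real" and c assume g: "\<forall>s. 0 \<le> g s" and c: "0 \<le> c" and gc: "lp_le q c g"
      have gb: "\<bar>g s\<bar> \<le> c" for s using lp_le_pointwise[OF gc] q c by simp
      have "lp_le q (8 * M * (8 * M * c)) (green \<sigma> (Suc n) (green \<sigma> (Suc n) g))"
        using g c gc M \<sigma> by (intro green) (auto intro!: green green_nonneg)
      then have "lp_le q (8 * M * (8 * M * c)) (\<lambda>s. real (Suc n) * (inverse \<sigma> ^ (n + 2) * conv (m n) g s))"
      proof (rule lp_le_mono)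
        show "\<bar>real (Suc n) * (inverse \<sigma> ^ (n + 2) * conv (m n) g s)\<bar> \<le> \<bar>green \<sigma> (Suc n) (green \<sigma> (Suc n) g) s\<bar>" for s
          using green_green_ge[where t = \<sigma> and g = g and c = c and n = n and s = s, OF \<sigma> _ gb] g \<sigma>
          by (simp add: abs_mult conv_nonneg)
      qed (use q c M in auto)
      from lp_le_scale[OF this, of "\<sigma> ^ (n + 2) / Suc n"] c M \<sigma>
      have "lp_le q (\<sigma> ^ (n + 2) / Suc n * (8 * M * (8 * M * c)))
         (\<lambda>s. \<sigma> ^ (n + 2) / Suc n * (real (Suc n) * (inverse \<sigma> ^ (n + 2) * conv (m n) g s)))"
        by simp
      moreover have "\<sigma> ^ (n + 2) / Suc n * (real (Suc n) * (inverse \<sigma> ^ (n + 2) * z)) = z" for z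
        using \<sigma> by (simp add: field_simps power_inverse del: power_Suc of_nat_Suc power_add_numeral)
      moreover have "\<sigma> ^ (n + 2) / Suc n * (8 * M * (8 * M * c)) = 64 * M\<^sup>2 * \<sigma>\<^sup>2 / Suc n * \<sigma> ^ n * c"
        by (simp add: power2_eq_square power_add mult_ac)
      ultimately show "lp_le q (64 * M\<^sup>2 * \<sigma>\<^sup>2 / Suc n * \<sigma> ^ n * c) (conv (m n) g)" by (simp only:)
    qed
    \<comment> \<open>For this \<open>n\<close> the factor in front of \<open>\<sigma> ^ n\<close>
      in \<open>op\<close> is at most 1/2, so the \<open>n\<close>-th root \<open>s\<close> of
      \<open>\<sigma> ^ n / 2\<close> is a growth rate strictly below the infimum.\<close>
    obtain n :: nat where n: "128 * M\<^sup>2 * \<sigma>\<^sup>2 < real n" using reals_Archimedean2 by blast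
    moreover have "0 \<le> 128 * M\<^sup>2 * \<sigma>\<^sup>2" by simp
    ultimately have n0: "0 < n" by (metis of_nat_0_less_iff le_less_trans)
    define s where "s = \<sigma> * (1 / 2) powr (1 / n)"
    have s0: "0 < s" using \<sigma> by (simp add: s_def)
    have sn: "s ^ n = \<sigma> ^ n / 2"
      using n0 by (simp add: s_def power_mult_distrib powr_realpow[symmetric] powr_powr)
    have "op_le q (s ^ n) (m n)"
    proof (rule op_le_mono[OF op])
      have "64 * M\<^sup>2 * \<sigma>\<^sup>2 / Suc n \<le> 1 / 2" using n by (simp add: field_simps)
      from mult_right_mono[OF this, of "\<sigma> ^ n"] \<sigma>
      show "64 * M\<^sup>2 * \<sigma>\<^sup>2 / Suc n * \<sigma> ^ n \<le> s ^ n" by (simp add: sn)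
    qed (use q M \<sigma> in auto)
    then have "growth q s" by (rule growth_if_op_le[OF _ n0 s0 q])
    then have "\<sigma> \<le> s" unfolding \<sigma>_def using bdd by (intro cInf_lower) auto
    moreover have "(1 / 2 :: real) powr (1 / n) < 1" using powr_less_mono2[of "1 / n" "1 / 2" 1] n0 by simp
    ultimately show False using \<sigma> by (simp add: s_def)
  qed
qed

text \<open>The infimum of the growth rates is a spectral value, and every growth rate bounds the
  spectrum; hence the supremum is over a nonempty bounded set. Entropy will supply the positive
  lower bound \<open>x\<close>.\<close>

lemma PF_spectral_radius_bounds:
  assumes q: "1 \<le> q" and x: "0 < x" "\<And>t. growth q t \<Longrightarrow> x \<le> t"
  shows "x \<le> PF_spectral_radius q \<mu>c" "growth q t \<Longrightarrow> PF_spectral_radius q \<mu>c \<le> t"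
proof -
  note \<sigma> = Inf_growth_in_PF_spectrum[OF q x]
  have le: "norm z \<le> t" if "z \<in> PF_spectrum q \<mu>c" "growth q t" for z t
    using not_in_PF_spectrum[OF that(2) _ q] that(1) by (meson not_le)
  have bdd: "bdd_above (cmod ` PF_spectrum q \<mu>c)"
    using le[OF _ growth_one[OF q]] by (auto intro!: bdd_aboveI)
  have "x \<le> cmod (complex_of_real (Inf {t. growth q t}))" using \<sigma>(2) x by simp
  also have "\<dots> \<le> PF_spectral_radius q \<mu>c"
    unfolding PF_spectral_radius_def by (rule cSup_upper[OF imageI[OF \<sigma>(1)] bdd])
  finally show "x \<le> PF_spectral_radius q \<mu>c" .
  show "PF_spectral_radius q \<mu>c \<le> t" if "growth q t"
    unfolding PF_spectral_radius_def using \<sigma>(1) le[OF _ that] by (intro cSup_least) auto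
qed

end

section \<open>Interpolation under property RD\<close>

text \<open>RD in the form used for interpolation: real functions, finite sums and squared norms.
  Enlarging the constant to at least 1 is harmless.\<close>

lemma property_RD_real:
  fixes L :: "'g::group_add \<Rightarrow> real"
  assumes "property_RD L"
  obtains d C where "1 \<le> C"
    "\<And>E S f g c. finite E \<Longrightarrow> finite S \<Longrightarrow> lp_le 2 c g \<Longrightarrow> 0 \<le> c \<Longrightarrow>
      (\<Sum>s\<in>S. (\<Sum>t\<in>E. f t * g (- t + s))\<^sup>2) \<le> C\<^sup>2 * (\<Sum>t\<in>E. (f t * (1 + L t) ^ d)\<^sup>2) * c\<^sup>2"
proof -
  from assms obtain d C where dC: "\<And>f g :: 'g \<Rightarrow> complex. finite {s. f s \<noteq> 0} \<Longrightarrow> in_lp 2 g \<Longrightarrow>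
      in_lp 2 (conv f g) \<and> lp_norm 2 (conv f g) \<le> C * weighted_l2_norm L d f * lp_norm 2 g"
    unfolding property_RD_def by metis
  show thesis
  proof (rule that[of "max 1 C"])
    fix E S :: "'g set" and f g :: "'g \<Rightarrow> real" and c
    assume E: "finite E" and S: "finite S" and g: "lp_le 2 c g" and c: "0 \<le> c"
    define f' where "f' t = (if t \<in> E then complex_of_real (f t) else 0)" for t
    define g' where "g' t = complex_of_real (g t)" for t
    define W where "W = weighted_l2_norm L d f'"
    have g': "in_lp 2 g'" "lp_norm 2 g' \<le> c"
      using g c lp_le_iff_lp_norm[of 2 c g'] by (auto simp: g'_def lp_le_def)
    have fin: "finite {s. f' s \<noteq> 0}" using E by (rule rev_finite_subset) (auto simp: f'_def)
    have conv: "conv f' g' s = complex_of_real (\<Sum>t\<in>E. f t * g (- t + s))" for s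
    proof -
      have "((\<lambda>t. f' t * g' (- t + s)) has_sum (\<Sum>t\<in>E. f' t * g' (- t + s))) UNIV"
        by (rule has_sum_finite_neutralI[OF E]) (auto simp: f'_def)
      then show ?thesis by (simp add: conv_def infsumI f'_def g'_def)
    qed
    have "((\<lambda>s. (norm (f' s))\<^sup>2 * ((1 + L s) ^ d)\<^sup>2) has_sum (\<Sum>t\<in>E. (f t * (1 + L t) ^ d)\<^sup>2)) UNIV"
      by (rule has_sum_finite_neutralI[OF E]) (auto simp: f'_def power_mult_distrib)
    then have W2: "W\<^sup>2 = (\<Sum>t\<in>E. (f t * (1 + L t) ^ d)\<^sup>2)"
      by (simp add: W_def weighted_l2_norm_def infsumI sum_nonneg)
    have W0: "0 \<le> W" by (simp add: W_def weighted_l2_norm_def infsum_nonneg)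
    have "lp_norm 2 (conv f' g') \<le> C * W * lp_norm 2 g'" using dC[OF fin g'(1)] by (simp add: W_def)
    also have "\<dots> \<le> max 1 C * W * c"
      using W0 g' by (intro mult_mono mult_nonneg_nonneg) (auto simp: lp_norm_nonneg)
    finally have "lp_le 2 (max 1 C * W * c) (\<lambda>s. norm (conv f' g' s))"
      using dC[OF fin g'(1)] W0 c by (subst lp_le_iff_lp_norm) auto
    from lp_leD[OF this S] have "(\<Sum>s\<in>S. \<bar>\<Sum>t\<in>E. f t * g (- t + s)\<bar>\<^sup>2) \<le> (max 1 C * W * c)\<^sup>2"
      unfolding conv norm_of_real using W0 c by simp
    then show "(\<Sum>s\<in>S. (\<Sum>t\<in>E. f t * g (- t + s))\<^sup>2) \<le> (max 1 C)\<^sup>2 * (\<Sum>t\<in>E. (f t * (1 + L t) ^ d)\<^sup>2) * c\<^sup>2"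
      by (simp add: power_mult_distrib W2)
  qed simp
qed

text \<open>Interpolation between \<open>\<ell>\<^sup>1\<close> and the \<open>\<ell>\<^sup>2\<close>-bound given by RD. For nonnegative functions Hoelder's
  inequality replaces the Riesz--Thorin theorem: write \<open>f = f\<^sub>0\<^sup>1\<^sup>-\<^sup>\<theta> f\<^sub>1\<^sup>\<theta>\<close> and \<open>g = g\<^sub>0\<^sup>1\<^sup>-\<^sup>\<theta> g\<^sub>1\<^sup>\<theta>\<close>, so that
  \<open>f * g \<le> (f\<^sub>0 * g\<^sub>0)\<^sup>1\<^sup>-\<^sup>\<theta> (f\<^sub>1 * g\<^sub>1)\<^sup>\<theta>\<close>.\<close>

lemma op_le_interpolation:
  fixes f \<omega> :: "'g::group_add \<Rightarrow> real"
  assumes C: "1 \<le> C"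
    and RD: "\<And>E S f g c. finite E \<Longrightarrow> finite S \<Longrightarrow> lp_le 2 c g \<Longrightarrow> 0 \<le> c \<Longrightarrow>
      (\<Sum>s\<in>S. (\<Sum>t\<in>E. f t * g (- t + s))\<^sup>2) \<le> C\<^sup>2 * (\<Sum>t\<in>E. (f t * \<omega> t)\<^sup>2) * c\<^sup>2"
    and \<omega>: "\<And>t. 0 < \<omega> t" and f: "\<And>t. 0 \<le> f t" "f summable_on UNIV"
    and \<epsilon>: "0 < \<epsilon>" "\<epsilon> < 1"
    and A: "\<And>E. finite E \<Longrightarrow> (\<Sum>t\<in>E. f t powr (1 + \<epsilon>) * \<omega> t powr (2 * \<epsilon>)) \<le> A"
  shows "op_le (1 + \<epsilon>) ((A * C powr (2 * \<epsilon>)) powr (1 / (1 + \<epsilon>))) f"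
  unfolding op_le_def
proof (intro allI impI)
  fix g :: "'g \<Rightarrow> real" and c assume g: "\<forall>s. 0 \<le> g s" and c: "0 \<le> c" and gc: "lp_le (1 + \<epsilon>) c g"
  define q where "q = 1 + \<epsilon>"
  \<comment> \<open>\<open>\<theta>\<close> solves
    \<open>1 / q = (1 - \<theta>) / 1 + \<theta> / 2\<close>.\<close>
  define \<theta> where "\<theta> = 2 * \<epsilon> / q"
  \<comment> \<open>The endpoint functions are \<open>P\<close> and
    \<open>P powr (1 / 2) / \<omega>\<close>, chosen so that the l^1 norm of the first and the
    squared weighted l^2 norm of the second are the same sum of \<open>P\<close>, bounded by
    \<open>A\<close>.\<close>
  define P where "P t = f t powr q * \<omega> t powr (2 * \<epsilon>)" for t
  define K where "K = (A * C powr (2 * \<epsilon>)) powr (1 / q)"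
  have q: "1 < q" using \<epsilon> by (simp add: q_def)
  have gq: "lp_le q c g" using gc by (simp add: q_def)
  have \<theta>: "0 < \<theta>" "\<theta> < 1" using \<epsilon> q by (auto simp: \<theta>_def q_def field_simps)
  have q\<theta>: "(1 - \<theta>) * q = 1 - \<epsilon>" "\<theta> * q = 2 * \<epsilon>" using q by (auto simp: \<theta>_def q_def field_simps)
  have P0: "0 \<le> P t" for t by (simp add: P_def)
  have A0: "0 \<le> A" using A[of "{}"] by simp
  have fg: "f t * g s = (P t * g s powr q) powr (1 - \<theta>) * (P t powr (1 / 2) / \<omega> t * g s powr (q / 2)) powr \<theta>" for t s
  proof (cases "f t = 0 \<or> g s = 0")
    case True
    then show ?thesis by (auto simp: P_def)
  next
    case False
    then have "0 < f t" "0 < g s" using f g by (auto simp: order_less_le)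
    \<comment> \<open>Writing the positive values as exponentials reduces the factorization to an
      identity between linear exponents.\<close>
    then obtain u v w where uvw: "f t = exp u" "g s = exp v" "\<omega> t = exp w"
      using \<omega>[of t] by (metis exp_ln)
    have "(P t * g s powr q) powr (1 - \<theta>) * (P t powr (1 / 2) / \<omega> t * g s powr (q / 2)) powr \<theta> =
      exp ((1 - \<theta>) * (q * u + 2 * \<epsilon> * w + q * v) + \<theta> * ((q * u + 2 * \<epsilon> * w) / 2 - w + q / 2 * v))"
      by (simp add: P_def uvw powr_def exp_add[symmetric] exp_diff[symmetric])
    also have "(1 - \<theta>) * (q * u + 2 * \<epsilon> * w + q * v) + \<theta> * ((q * u + 2 * \<epsilon> * w) / 2 - w + q / 2 * v) = u + v"
    proof -
      have "(1 - \<theta>) * (q * u + 2 * \<epsilon> * w + q * v) + \<theta> * ((q * u + 2 * \<epsilon> * w) / 2 - w + q / 2 * v) =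
        (u + v) * (q - \<theta> * q / 2) + w * (2 * \<epsilon> - \<epsilon> * \<theta> - \<theta>)"
        by (simp add: field_simps)
      moreover have "q - \<theta> * q / 2 = 1" unfolding q\<theta> by (simp add: q_def)
      moreover have "2 * \<epsilon> - \<epsilon> * \<theta> - \<theta> = 0" using q\<theta>(2) by (simp add: q_def algebra_simps)
      ultimately show ?thesis by simp
    qed
    finally show ?thesis by (simp add: uvw exp_add)
  qed
  have partial: "lp_le q (K * c) (\<lambda>s. \<Sum>t\<in>E. f t * g (- t + s))" if E: "finite E" for E
    unfolding lp_le_def
  proof (intro allI impI)
    fix S :: "'g set" assume S: "finite S"
    define a where "a s = (\<Sum>t\<in>E. P t * g (- t + s) powr q)" for s
    define b where "b s = (\<Sum>t\<in>E. P t powr (1 / 2) / \<omega> t * g (- t + s) powr (q / 2))" for s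
    have a0: "0 \<le> a s" and b0: "0 \<le> b s" for s
      using P0 less_imp_le[OF \<omega>]
      by (auto simp: a_def b_def intro!: sum_nonneg mult_nonneg_nonneg divide_nonneg_nonneg)
    have "\<bar>\<Sum>t\<in>E. f t * g (- t + s)\<bar> powr q \<le> a s powr (1 - \<epsilon>) * ((b s)\<^sup>2) powr (1 - (1 - \<epsilon>))" for s
    proof -
      \<comment> \<open>Hoelder is used twice: here over \<open>t\<close> for fixed \<open>s\<close>
        with exponent \<open>\<theta>\<close>, and afterwards over \<open>s\<close> with exponent
        \<open>\<epsilon>\<close>.\<close>
      have "(\<Sum>t\<in>E. f t * g (- t + s)) \<le> a s powr (1 - \<theta>) * b s powr (1 - (1 - \<theta>))"
        unfolding a_def b_def fg using E P0 less_imp_le[OF \<omega>] \<theta>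
        by (intro order_trans[OF eq_refl Holder_sum]) (auto intro!: mult_nonneg_nonneg divide_nonneg_nonneg)
      then have "\<bar>\<Sum>t\<in>E. f t * g (- t + s)\<bar> powr q \<le> (a s powr (1 - \<theta>) * b s powr \<theta>) powr q"
        using f g q sum_nonneg[of E "\<lambda>t. f t * g (- t + s)"] by (intro powr_mono2) auto
      also have "\<dots> = a s powr (1 - \<epsilon>) * b s powr (2 * \<epsilon>)"
        by (simp add: powr_mult powr_powr q\<theta>)
      also have "b s powr (2 * \<epsilon>) = ((b s)\<^sup>2) powr \<epsilon>"
        using b0[of s] by (cases "b s = 0") (auto simp: powr_powr simp flip: powr_numeral)
      finally show ?thesis by simp
    qed
    then have "(\<Sum>s\<in>S. \<bar>\<Sum>t\<in>E. f t * g (- t + s)\<bar> powr q) \<le>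
      (\<Sum>s\<in>S. a s powr (1 - \<epsilon>) * ((b s)\<^sup>2) powr (1 - (1 - \<epsilon>)))" by (rule sum_mono)
    also have "\<dots> \<le> (\<Sum>s\<in>S. a s) powr (1 - \<epsilon>) * (\<Sum>s\<in>S. (b s)\<^sup>2) powr (1 - (1 - \<epsilon>))"
      using S a0 \<epsilon> by (intro Holder_sum) auto
    \<comment> \<open>The first sum is the l^1 endpoint, where translation invariance suffices; the
      second is the l^2 endpoint, where RD enters.\<close>
    also have "\<dots> \<le> (A * c powr q) powr (1 - \<epsilon>) * (C\<^sup>2 * A * c powr q) powr (1 - (1 - \<epsilon>))"
    proof (intro mult_mono powr_mono2)
      have "(\<Sum>s\<in>S. a s) = (\<Sum>t\<in>E. P t * (\<Sum>s\<in>S. \<bar>g (- t + s)\<bar> powr q))"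
        unfolding a_def using g by (subst sum.swap) (simp add: sum_distrib_left)
      also have "\<dots> \<le> (\<Sum>t\<in>E. P t * c powr q)"
        using lp_leD[OF lp_le_translate[OF gc] S] P0 by (intro sum_mono mult_left_mono) (auto simp: q_def)
      also have "\<dots> = (\<Sum>t\<in>E. P t) * c powr q" by (simp add: sum_distrib_right)
      also have "\<dots> \<le> A * c powr q" using A[OF E] by (intro mult_right_mono) (auto simp: P_def q_def)
      finally show "(\<Sum>s\<in>S. a s) \<le> A * c powr q" .
      have "lp_le 2 (c powr (q / 2)) (\<lambda>s. g s powr (q / 2))"
        using gq g c by (simp add: lp_le_def powr_powr)
      from RD[OF E S this, of "\<lambda>t. P t powr (1 / 2) / \<omega> t"]
      have "(\<Sum>s\<in>S. (b s)\<^sup>2) \<le> C\<^sup>2 * (\<Sum>t\<in>E. (P t powr (1 / 2))\<^sup>2) * (c powr (q / 2))\<^sup>2"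
        using \<omega> by (simp add: b_def less_imp_neq[symmetric])
      also have "(\<Sum>t\<in>E. (P t powr (1 / 2))\<^sup>2) = (\<Sum>t\<in>E. P t)"
        using P0 by (simp add: powr_half_sqrt)
      also have "(c powr (q / 2))\<^sup>2 = c powr q"
        by (simp add: power2_eq_square powr_add[symmetric])
      also have "C\<^sup>2 * (\<Sum>t\<in>E. P t) * c powr q \<le> C\<^sup>2 * A * c powr q"
        using A[OF E] by (intro mult_right_mono mult_left_mono) (auto simp: P_def q_def)
      finally show "(\<Sum>s\<in>S. (b s)\<^sup>2) \<le> C\<^sup>2 * A * c powr q" .
    qed (use \<epsilon> a0 A0 C in \<open>auto intro!: sum_nonneg\<close>)
    also have "\<dots> = (A * c powr q) powr (1 - \<epsilon>) * (A * c powr q) powr \<epsilon> * C powr (2 * \<epsilon>)"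
      using A0 C by (simp add: powr_mult powr_powr flip: powr_numeral)
    also have "\<dots> = (A * C powr (2 * \<epsilon>)) * c powr q"
      using A0 by (simp add: powr_add[symmetric])
    also have "\<dots> = (K * c) powr q"
      using q A0 by (simp add: K_def powr_mult powr_powr)
    finally show "(\<Sum>s\<in>S. \<bar>\<Sum>t\<in>E. f t * g (- t + s)\<bar> powr q) \<le> (K * c) powr q" .
  qed
  have fn: "(\<lambda>t. norm (f t)) summable_on UNIV" using f by simp
  have gb: "norm (g s) \<le> c" for s using lp_le_pointwise[OF gc] \<epsilon> c by simp
  have lim: "((\<lambda>E. \<Sum>t\<in>E. f t * g (- t + s)) \<longlongrightarrow> conv f g s) (finite_subsets_at_top UNIV)" for s
    using has_sum_conv[where s = s and g = g, OF fn gb] by (simp add: has_sum_def)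
  have "lp_le q (K * c) (conv f g)"
    by (rule lp_le_lim[OF _ _ lim]) (use q in \<open>auto intro!: eventually_finite_subsets_at_top_weakI partial\<close>)
  then show "lp_le (1 + \<epsilon>) ((A * C powr (2 * \<epsilon>)) powr (1 / (1 + \<epsilon>)) * c) (conv f g)"
    by (simp add: K_def q_def)
qed

text \<open>Dominated convergence along a filter: a finite set carries all but \<open>e / 2\<close>
  of the dominating sum, and on it pointwise convergence is enough.\<close>

lemma infsum_dominated_tendsto_0:
  fixes u :: "'i \<Rightarrow> 'b \<Rightarrow> real"
  assumes g: "g summable_on UNIV" and u: "\<forall>\<^sub>F i in G. \<forall>s. 0 \<le> u i s \<and> u i s \<le> g s"
    and lim: "\<And>s. ((\<lambda>i. u i s) \<longlongrightarrow> 0) G" and e: "0 < e"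
  shows "\<forall>\<^sub>F i in G. u i summable_on UNIV \<and> (\<Sum>\<^sub>\<infinity>s. u i s) < e"
proof -
  obtain F where F: "finite F" "dist (sum g F) (infsum g UNIV) \<le> e / 2"
    using infsum_finite_approximation[OF g, of "e / 2"] e by auto
  have "((\<lambda>i. \<Sum>s\<in>F. u i s) \<longlongrightarrow> (\<Sum>s\<in>F. 0)) G" by (intro tendsto_sum lim)
  then have "\<forall>\<^sub>F i in G. (\<Sum>s\<in>F. u i s) < e / 2" using e by (intro order_tendstoD) auto
  with u show ?thesis
  proof eventually_elim
    case (elim i)
    have ui: "u i summable_on UNIV" by (rule summable_on_comparison_test[OF g]) (use elim in auto)
    have split: "infsum h UNIV = sum h F + infsum h (- F)" if "h summable_on UNIV" for h :: "'b \<Rightarrow> real"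
      using infsum_Un_disjoint[of h F "- F"] that F summable_on_subset[OF that, of "- F"] by simp
    have "infsum (u i) (- F) \<le> infsum g (- F)"
      using elim by (intro infsum_mono summable_on_subset[OF ui] summable_on_subset[OF g]) auto
    also have "\<dots> \<le> e / 2" using split[OF g] F by (simp add: dist_real_def)
    finally show ?case using split[OF ui] ui elim by simp
  qed
qed

text \<open>Convexity makes \<open>\<epsilon> \<mapsto> (e\<^sup>\<epsilon>\<^sup>x - 1) / \<epsilon>\<close> increasing, which provides the dominating function.\<close>

lemma infsum_exp_le:
  fixes f X :: "'b \<Rightarrow> real"
  assumes f: "\<And>s. 0 \<le> f s" "(f has_sum 1) UNIV" and fX: "((\<lambda>s. f s * X s) has_sum D) UNIV"
    and \<epsilon>0: "0 < \<epsilon>0" and sum: "(\<lambda>s. f s * exp (\<epsilon>0 * X s)) summable_on UNIV" and \<delta>: "0 < \<delta>"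
  shows "\<forall>\<^sub>F \<epsilon> in at_right 0. (\<lambda>s. f s * exp (\<epsilon> * X s)) summable_on UNIV \<and>
    (\<Sum>\<^sub>\<infinity>s. f s * exp (\<epsilon> * X s)) \<le> exp (\<epsilon> * (D + \<delta>))"
proof -
  \<comment> \<open>Difference quotient minus derivative at 0, weighted by \<open>f\<close>. It is
    nonnegative and increases with \<open>\<epsilon>\<close>, so \<open>u \<epsilon>0\<close>
    dominates.\<close>
  define u where "u \<epsilon> s = f s * ((exp (\<epsilon> * X s) - 1) / \<epsilon> - X s)" for \<epsilon> s
  have fs: "f summable_on UNIV" and fXs: "(\<lambda>s. f s * X s) summable_on UNIV"
    using f(2) fX by (auto simp: has_sum_iff)
  have u_eq: "u \<epsilon> s = (1 / \<epsilon>) * (f s * exp (\<epsilon> * X s)) - (1 / \<epsilon>) * f s - f s * X s" if "\<epsilon> \<noteq> 0" for \<epsilon> s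
    using that by (simp add: u_def field_simps)
  have "u \<epsilon>0 summable_on UNIV"
    using \<epsilon>0 summable_on_add[OF summable_on_add[OF summable_on_cmult_right[OF sum, of "1 / \<epsilon>0"]
      summable_on_cmult_right[OF fs, of "- 1 / \<epsilon>0"]] summable_on_cmult_right[OF fXs, of "-1"]]
    by (simp add: u_eq cong: summable_on_cong)
  moreover have "\<forall>\<^sub>F \<epsilon> in at_right 0. \<epsilon> < \<epsilon>0" "\<forall>\<^sub>F \<epsilon> in at_right (0::real). 0 < \<epsilon>"
    using \<epsilon>0 by (auto simp: eventually_at_right_less intro: eventually_at_right_real[THEN eventually_mono])
  then have "\<forall>\<^sub>F \<epsilon> in at_right 0. \<forall>s. 0 \<le> u \<epsilon> s \<and> u \<epsilon> s \<le> u \<epsilon>0 s"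
  proof eventually_elim
    case (elim \<epsilon>)
    show ?case
    proof
      fix s
      have "X s \<le> (exp (\<epsilon> * X s) - 1) / \<epsilon>"
        using exp_ge_add_one_self[of "\<epsilon> * X s"] elim by (simp add: field_simps)
      moreover have "(exp (\<epsilon> * X s) - 1) / \<epsilon> \<le> (exp (\<epsilon>0 * X s) - 1) / \<epsilon>0"
      proof -
        have "exp (\<epsilon>0 * X s) powr (\<epsilon> / \<epsilon>0) * 1 powr (1 - \<epsilon> / \<epsilon>0) \<le> \<epsilon> / \<epsilon>0 * exp (\<epsilon>0 * X s) + (1 - \<epsilon> / \<epsilon>0) * 1"
          using elim \<epsilon>0 by (intro Youngs_inequality_0) auto
        then have "exp (\<epsilon> * X s) - 1 \<le> \<epsilon> * ((exp (\<epsilon>0 * X s) - 1) / \<epsilon>0)"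
          using elim \<epsilon>0 by (simp add: powr_def diff_divide_distrib right_diff_distrib)
        then show ?thesis using elim by (simp add: field_simps)
      qed
      ultimately show "0 \<le> u \<epsilon> s \<and> u \<epsilon> s \<le> u \<epsilon>0 s"
        using f(1)[of s] by (auto simp: u_def intro!: mult_left_mono)
    qed
  qed
  moreover have "((\<lambda>\<epsilon>. u \<epsilon> s) \<longlongrightarrow> 0) (at_right 0)" for s
  proof -
    have "((\<lambda>\<epsilon>. exp (\<epsilon> * X s)) has_field_derivative X s) (at 0)"
      by (auto intro!: derivative_eq_intros)
    then have "((\<lambda>\<epsilon>. (exp (\<epsilon> * X s) - 1) / \<epsilon>) \<longlongrightarrow> X s) (at 0)"
      by (simp add: DERIV_def)
    then have "((\<lambda>\<epsilon>. (exp (\<epsilon> * X s) - 1) / \<epsilon>) \<longlongrightarrow> X s) (at_right 0)"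
      by (rule filterlim_mono) (simp_all add: at_le)
    then have "((\<lambda>\<epsilon>. u \<epsilon> s) \<longlongrightarrow> f s * (X s - X s)) (at_right 0)"
      unfolding u_def by (intro tendsto_intros)
    then show ?thesis by simp
  qed
  ultimately have "\<forall>\<^sub>F \<epsilon> in at_right 0. u \<epsilon> summable_on UNIV \<and> (\<Sum>\<^sub>\<infinity>s. u \<epsilon> s) < \<delta>"
    using \<delta> by (rule infsum_dominated_tendsto_0)
  moreover have "\<forall>\<^sub>F \<epsilon> in at_right (0::real). 0 < \<epsilon>" by (simp add: eventually_at_right_less)
  ultimately show ?thesis
  proof eventually_elim
    case (elim \<epsilon>)
    then have u: "(u \<epsilon> has_sum (\<Sum>\<^sub>\<infinity>s. u \<epsilon> s)) UNIV" by (intro has_sum_infsum) auto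
    \<comment> \<open>Solving the definition of \<open>u\<close> for the exponential gives the
      first-order expansion of the sum, with error \<open>\<epsilon>\<close> times the sum of
      \<open>u \<epsilon>\<close>.\<close>
    have "((\<lambda>s. \<epsilon> * (u \<epsilon> s + f s * X s) + f s) has_sum \<epsilon> * ((\<Sum>\<^sub>\<infinity>s. u \<epsilon> s) + D) + 1) UNIV"
      by (intro has_sum_add has_sum_cmult_right u fX f)
    moreover have "\<epsilon> * (u \<epsilon> s + f s * X s) + f s = f s * exp (\<epsilon> * X s)" for s
      using elim by (simp add: u_def field_simps)
    ultimately have "((\<lambda>s. f s * exp (\<epsilon> * X s)) has_sum \<epsilon> * ((\<Sum>\<^sub>\<infinity>s. u \<epsilon> s) + D) + 1) UNIV" by simp
    moreover have "\<epsilon> * ((\<Sum>\<^sub>\<infinity>s. u \<epsilon> s) + D) + 1 \<le> \<epsilon> * (D + \<delta>) + 1"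
      using elim by (intro add_right_mono mult_left_mono) auto
    moreover have "\<epsilon> * (D + \<delta>) + 1 \<le> exp (\<epsilon> * (D + \<delta>))"
      using exp_ge_add_one_self[of "\<epsilon> * (D + \<delta>)"] by (simp only: add.commute)
    ultimately show ?case by (auto simp: has_sum_iff)
  qed
qed

section \<open>Entropy\<close>

lemma ent_term_eq: "ent_term x = x * - ln x"
  by (simp add: ent_term_def)

lemma prob_measure_le_1:
  assumes "prob_measure f"
  shows "f s \<le> 1"
proof -
  have "sum f {s} \<le> infsum f UNIV"
    using assms by (intro finite_sum_le_infsum) (auto simp: prob_measure_def has_sum_iff)
  then show ?thesis using assms by (auto simp: prob_measure_def has_sum_iff)
qed

lemma ent_term_nonneg: "0 \<le> x \<Longrightarrow> x \<le> 1 \<Longrightarrow> 0 \<le> ent_term x"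
  by (cases "x = 0") (auto simp: ent_term_eq mult_nonneg_nonpos)

lemma shannon_entropy_nonneg: "prob_measure f \<Longrightarrow> 0 \<le> shannon_entropy f"
  unfolding shannon_entropy_def
  by (intro infsum_nonneg ent_term_nonneg prob_measure_le_1) (auto simp: prob_measure_def)

lemma has_sum_entropy: "finite_entropy f \<Longrightarrow> ((\<lambda>s. f s * - ln (f s)) has_sum shannon_entropy f) UNIV"
  using has_sum_infsum[of "\<lambda>s. ent_term (f s)" UNIV]
  by (simp add: finite_entropy_def shannon_entropy_def ent_term_eq)

text \<open>One summand of the convolution gives \<open>conv f h (t + u) \<ge> f t * h u\<close>.
  Hence \<open>- ln (conv f h)\<close> is subadditive along the supports and
  \<open>conv_weighted_bound\<close> applies to it.\<close>

lemma entropy_conv: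
  fixes f h :: "'g::group_add \<Rightarrow> real"
  assumes f: "prob_measure f" "finite_entropy f" and h: "prob_measure h" "finite_entropy h"
  shows "finite_entropy (conv f h)" "shannon_entropy (conv f h) \<le> shannon_entropy f + shannon_entropy h"
proof -
  note fh = prob_measure_conv[OF f(1) h(1)]
  have f0: "0 \<le> f s" and h0: "0 \<le> h s" for s using f h by (auto simp: prob_measure_def)
  have fn: "(\<lambda>t. norm (f t)) summable_on UNIV" and hn: "(\<lambda>t. norm (h t)) summable_on UNIV"
    using f h f0 h0 by (auto simp: prob_measure_def has_sum_iff)
  have 1: "0 \<le> - ln (conv f h s)" for s
    using prob_measure_le_1[OF fh, of s] fh by (cases "conv f h s = 0") (auto simp: prob_measure_def order_less_le)
  have 2: "- ln (conv f h (t + u)) \<le> - ln (f t) + - ln (h u)" if "0 < f t" "0 < h u" for t u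
  proof -
    have "sum (\<lambda>t'. f t' * h (- t' + (t + u))) {t} \<le> conv f h (t + u)"
      unfolding conv_def
      by (rule finite_sum_le_infsum[OF summable_on_conv(2)[OF fn norm_le_infsum_norm[OF hn]]])
         (auto simp: f0 h0)
    then have "f t * h u \<le> conv f h (t + u)" by (simp add: add.assoc[symmetric])
    then have "ln (f t * h u) \<le> ln (conv f h (t + u))"
      using that by (intro ln_mono) auto
    then show ?thesis using that by (simp add: ln_mult)
  qed
  note conv_weighted_bound[where \<phi> = "\<lambda>v. - ln (conv f h v)" and a = "\<lambda>t. - ln (f t)" and b = "\<lambda>t. - ln (h t)",
    OF f(1) h(1) 1 2 has_sum_entropy[OF f(2)] has_sum_entropy[OF h(2)]]
  then show "finite_entropy (conv f h)" "shannon_entropy (conv f h) \<le> shannon_entropy f + shannon_entropy h"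
    by (auto simp: finite_entropy_def shannon_entropy_def ent_term_eq)
qed

text \<open>Fekete's lemma, with the limit identified as an infimum so that it also bounds each
  single quotient from below.\<close>

lemma subadditive_limit:
  fixes H :: "nat \<Rightarrow> real"
  assumes sub: "\<And>j k. H (j + k) \<le> H j + H k" and nonneg: "\<And>n. 0 \<le> H n"
  obtains h where "(\<lambda>n. H n / real n) \<longlonglongrightarrow> h" "\<And>n. 0 < n \<Longrightarrow> h \<le> H n / real n"
proof -
  define h where "h = (INF n\<in>{0<..}. H n / real n)"
  have bdd: "bdd_below ((\<lambda>n. H n / real n) ` {0<..})" by (auto intro!: bdd_belowI[of _ 0] simp: nonneg)
  have lower: "h \<le> H n / real n" if "0 < n" for n
    unfolding h_def by (rule cINF_lower[OF bdd]) (use that in auto)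
  have "(\<lambda>n. H n / real n) \<longlonglongrightarrow> h"
  proof (rule order_tendstoI)
    fix a assume "a < h"
    show "\<forall>\<^sub>F n in sequentially. a < H n / real n"
      using eventually_gt_at_top[of "0::nat"] by eventually_elim (use lower \<open>a < h\<close> in \<open>auto intro: less_le_trans\<close>)
  next
    fix a assume a: "h < a"
    then obtain N where N: "0 < N" "H N / real N < a"
      unfolding h_def by (subst (asm) cINF_less_iff[OF _ bdd]) auto
    \<comment> \<open>One bound for \<open>H\<close> at all remainders modulo
      \<open>N\<close>.\<close>
    define R where "R = (\<Sum>b<N. H b)"
    have bound: "H n / real n \<le> H N / real N + R / real n" if n: "0 < n" for n
    proof -
      have mult: "H (N * k) \<le> real k * H N" if "0 < k" for k
        using that
      proof (induction k rule: nat_induct_non_zero)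
        case (Suc k)
        then show ?case using sub[of N "N * k"] by (simp add: algebra_simps)
      qed simp
      have R: "H (n mod N) \<le> R"
        unfolding R_def using N nonneg by (intro member_le_sum) auto
      \<comment> \<open>Quotient 0 is separate because \<open>H 0\<close> need not vanish, so
        \<open>mult\<close> starts at \<open>k = 1\<close>.\<close>
      have "H n \<le> real (n div N) * H N + R"
      proof (cases "n div N = 0")
        case True
        then have "n mod N = n" by (metis add.left_neutral mod_mult_div_eq add.commute mult_0_right)
        then show ?thesis using True R by simp
      next
        case False
        then show ?thesis using sub[of "N * (n div N)" "n mod N"] mult[of "n div N"] R by simp
      qed
      also have "real (n div N) * H N \<le> real n / real N * H N"
        by (intro mult_right_mono nonneg of_nat_div_le_of_nat)
      finally show ?thesis using n by (simp add: field_simps)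
    qed
    have "(\<lambda>n. H N / real N + R / real n) \<longlonglongrightarrow> H N / real N + 0"
      by (intro tendsto_add tendsto_const lim_const_over_n)
    then have "\<forall>\<^sub>F n in sequentially. H N / real N + R / real n < a"
      using N by (intro order_tendstoD) auto
    with eventually_gt_at_top[of "0::nat"] show "\<forall>\<^sub>F n in sequentially. H n / real n < a"
      by eventually_elim (use bound in \<open>auto intro: le_less_trans\<close>)
  qed
  then show thesis using lower by (rule that)
qed

text \<open>Monotonicity of the Renyi entropies: \<open>-ln \<Sum> f\<^sup>q \<le> (q - 1) H(f)\<close>.\<close>

lemma exp_entropy_le_lp:
  assumes f: "prob_measure f" "finite_entropy f" and q: "1 < q" and c: "lp_le q c f"
  shows "exp (- (q - 1) * shannon_entropy f) \<le> c powr q"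
proof -
  define H where "H = shannon_entropy f"
  define e where "e = exp (- (q - 1) * H)"
  have f0: "0 \<le> f s" for s using f by (simp add: prob_measure_def)
  \<comment> \<open>Jensen by a tangent line: \<open>exp x \<ge> 1 + x\<close> at
    \<open>x = (q - 1) * (H + ln (f s))\<close>. Summed over \<open>s\<close>, the terms in
    parentheses cancel and \<open>e\<close> remains.\<close>
  have le: "e * f s + (e * (q - 1)) * (H * f s - f s * - ln (f s)) \<le> f s powr q" for s
  proof (cases "f s = 0")
    case False
    then have fs: "0 < f s" using f0[of s] by simp
    have "e * (1 + (q - 1) * (H + ln (f s))) \<le> e * exp ((q - 1) * (H + ln (f s)))"
      using exp_ge_add_one_self[of "(q - 1) * (H + ln (f s))"] by (intro mult_left_mono) (auto simp: e_def)
    also have "\<dots> = exp ((q - 1) * ln (f s))" by (simp add: e_def exp_add[symmetric] algebra_simps)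
    finally have "f s * (e * (1 + (q - 1) * (H + ln (f s)))) \<le> f s * exp ((q - 1) * ln (f s))"
      using fs by (intro mult_left_mono) auto
    also have "\<dots> = f s powr q"
      using fs powr_mult_base[of "f s" "q - 1"] by (simp add: powr_def[of _ "q - 1"])
    finally show ?thesis by (simp add: algebra_simps)
  qed auto
  have f1: "(f has_sum 1) UNIV" using f by (simp add: prob_measure_def)
  have "((\<lambda>s. e * f s + (e * (q - 1)) * (H * f s + - (f s * - ln (f s)))) has_sum e * 1 + (e * (q - 1)) * (H * 1 + - H)) UNIV"
    using has_sum_entropy[OF f(2)] unfolding H_def[symmetric]
    by (intro has_sum_add has_sum_cmult_right has_sum_uminusI f1)
  then have "e * 1 + (e * (q - 1)) * (H * 1 + - H) \<le> c powr q"
  proof (rule has_sum_le_finite_sums)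
    fix F :: "'a set" assume F: "finite F"
    have "(\<Sum>s\<in>F. e * f s + (e * (q - 1)) * (H * f s + - (f s * - ln (f s)))) \<le> (\<Sum>s\<in>F. \<bar>f s\<bar> powr q)"
      using le f0 by (intro sum_mono) simp
    also have "\<dots> \<le> c powr q" by (rule lp_leD[OF c F])
    finally show "(\<Sum>s\<in>F. e * f s + (e * (q - 1)) * (H * f s + - (f s * - ln (f s)))) \<le> c powr q" .
  qed
  then show ?thesis by (simp add: e_def H_def)
qed

lemma powr_add_le:
  fixes x y \<beta> :: real
  assumes "0 < x" "0 < y" "0 < \<beta>" "\<beta> \<le> 1"
  shows "(x + y) powr \<beta> \<le> x powr \<beta> + y powr \<beta>"
proof -
  have *: "z / (x + y) \<le> (z / (x + y)) powr \<beta>" if "0 < z" "z \<le> x + y" for z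
    using powr_mono'[of \<beta> 1 "z / (x + y)"] that assms by simp
  have "1 = x / (x + y) + y / (x + y)" using assms by (simp add: add_divide_distrib[symmetric])
  also have "\<dots> \<le> (x / (x + y)) powr \<beta> + (y / (x + y)) powr \<beta>"
    using assms by (intro add_mono *) auto
  also have "\<dots> = (x powr \<beta> + y powr \<beta>) / (x + y) powr \<beta>"
    using assms by (simp add: powr_divide add_divide_distrib)
  finally show ?thesis using assms by (simp add: field_simps)
qed

text \<open>Jensen for the logarithm through its tangent at \<open>S\<close>:
  \<open>ln W \<le> ln S - 1 + W / S\<close>. An upper bound \<open>S\<close> for the mean is
  enough.\<close>

lemma infsum_ln_le:
  fixes f W :: "'b \<Rightarrow> real"
  assumes f: "prob_measure f" and W: "\<And>s. 1 \<le> W s"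
    and fW: "(\<lambda>s. f s * W s) summable_on UNIV" and S: "(\<Sum>\<^sub>\<infinity>s. f s * W s) \<le> S" "0 < S"
  shows "(\<lambda>s. f s * ln (W s)) summable_on UNIV" "(\<Sum>\<^sub>\<infinity>s. f s * ln (W s)) \<le> ln S"
proof -
  have f0: "0 \<le> f s" for s using f by (simp add: prob_measure_def)
  have f1: "(f has_sum 1) UNIV" using f by (simp add: prob_measure_def)
  define T where "T = (\<Sum>\<^sub>\<infinity>s. f s * W s)"
  have le: "f s * ln (W s) \<le> (ln S - 1) * f s + 1 / S * (f s * W s)" for s
  proof -
    have "ln (W s / S) \<le> W s / S - 1" using W[of s] S by (intro ln_le_minus_one) auto
    then have "ln (W s) \<le> (ln S - 1) + W s / S" using W[of s] S by (simp add: ln_div)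
    from mult_left_mono[OF this f0[of s]] show ?thesis by (simp add: algebra_simps)
  qed
  have sum: "((\<lambda>s. (ln S - 1) * f s + 1 / S * (f s * W s)) has_sum (ln S - 1) * 1 + 1 / S * T) UNIV"
    unfolding T_def by (intro has_sum_add has_sum_cmult_right f1 has_sum_infsum fW)
  have nn: "0 \<le> f s * ln (W s)" for s using f0 W by (intro mult_nonneg_nonneg) auto
  show 1: "(\<lambda>s. f s * ln (W s)) summable_on UNIV"
    by (rule summable_on_comparison_test[OF has_sum_imp_summable[OF sum] le nn])
  have "(\<Sum>\<^sub>\<infinity>s. f s * ln (W s)) \<le> (ln S - 1) * 1 + 1 / S * T"
    by (rule has_sum_mono[OF has_sum_infsum[OF 1] sum le])
  also have "\<dots> \<le> ln S" using S by (simp add: T_def field_simps)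
  finally show "(\<Sum>\<^sub>\<infinity>s. f s * ln (W s)) \<le> ln S" .
qed

section \<open>Moments, entropy and growth rates of the convolution powers\<close>

context random_walk
begin

text \<open>Subadditivity of \<open>w\<close> adds at most \<open>M\<close> per step; the 1 is
  \<open>w 0\<close>, the moment of \<open>delta\<close>.\<close>

lemma moment_conv_pow:
  fixes w :: "'g \<Rightarrow> real"
  assumes w: "\<And>s. 0 \<le> w s" "w 0 = 1" "\<And>s t. w (s + t) \<le> w s + w t"
    and \<mu>w: "((\<lambda>s. \<mu> s * w s) has_sum M) UNIV"
  shows "(\<lambda>s. m n s * w s) summable_on UNIV \<and> (\<Sum>\<^sub>\<infinity>s. m n s * w s) \<le> 1 + real n * M"
proof (induction n)
  case 0
  have "((\<lambda>s. m 0 s * w s) has_sum 1) UNIV"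
    by (rule has_sum_finite_neutralI[of "{0}"]) (auto simp: delta_def w(2))
  then show ?case by (auto simp: has_sum_iff)
next
  case (Suc n)
  then have "((\<lambda>s. m n s * w s) has_sum (\<Sum>\<^sub>\<infinity>s. m n s * w s)) UNIV" by (intro has_sum_infsum) auto
  note conv_weighted_bound[where \<phi> = w and a = w and b = w, OF prob prob_m w(1) w(3) \<mu>w this]
  with Suc show ?case by (auto simp: algebra_simps)
qed

lemma finite_entropy_m:
  assumes "finite_entropy \<mu>"
  shows "finite_entropy (m n)"
proof (induction n)
  case 0
  have "(\<lambda>s. ent_term (delta (s::'g))) = (\<lambda>s. 0)" by (auto simp: ent_term_def delta_def)
  then show ?case by (simp add: finite_entropy_def)
qed (simp add: entropy_conv assms prob prob_m)

text \<open>Applied to \<open>delta\<close>, the operator bound becomes an l^q bound on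
  \<open>m k\<close>, to be compared with its entropy. Dividing by \<open>k\<close> and letting
  \<open>k\<close> grow removes \<open>K\<close>. The factor \<open>(q - 1) / q\<close> is
  \<open>1 / p\<close>.\<close>

lemma exp_le_growth:
  assumes fe: "finite_entropy \<mu>" and h: "(\<lambda>n. shannon_entropy (m n) / real n) \<longlonglongrightarrow> h"
    and q: "1 < q" and gr: "growth q t"
  shows "exp (- ((q - 1) / q) * h) \<le> t"
proof -
  from gr obtain K where t: "0 < t" and K: "0 \<le> K" and op: "\<And>k. op_le q (K * t ^ k) (m k)"
    by (auto simp: growth_def)
  define H where "H k = shannon_entropy (m k)" for k
  have "lp_le q 1 (delta :: 'g \<Rightarrow> real)"
    unfolding lp_le_def
  proof (intro allI impI)
    fix F :: "'g set" assume F: "finite F"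
    have "(\<Sum>s\<in>F. \<bar>delta s\<bar> powr q) = (\<Sum>s\<in>F. if s = 0 then 1 else (0::real))"
      by (intro sum.cong) (auto simp: delta_def)
    then show "(\<Sum>s\<in>F. \<bar>delta s\<bar> powr q) \<le> (1::real) powr q" using F by simp
  qed
  then have "lp_le q (K * t ^ k * 1) (conv (m k) delta)" for k
    by (intro op_leD[OF op]) (auto simp: delta_def)
  then have lp: "lp_le q (K * t ^ k) (m k)" for k by (simp add: conv_delta_right)
  have le: "exp (- (q - 1) * H k) \<le> (K * t ^ k) powr q" for k
    unfolding H_def using exp_entropy_le_lp[OF prob_m finite_entropy_m[OF fe] q lp] .
  \<comment> \<open>Already at \<open>k = 0\<close>, \<open>K = 0\<close> would put a positive
    exponential below 0; positivity is needed for \<open>ln K\<close>.\<close>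
  have K0: "0 < K"
  proof (rule ccontr)
    assume "\<not> 0 < K"
    then have "K = 0" using K by simp
    with le[of 0] show False by (simp add: not_le[symmetric])
  qed
  have "- ((q - 1) / q) * (H k / real k) \<le> ln K / real k + ln t" if k: "0 < k" for k
  proof -
    have "ln (exp (- (q - 1) * H k)) \<le> ln ((K * t ^ k) powr q)"
      using le[of k] by (intro ln_mono) auto
    then have le': "- (q - 1) * H k \<le> q * (ln K + real k * ln t)"
      using K0 t by (simp add: ln_powr ln_mult ln_realpow)
    have "- ((q - 1) / q) * (H k / real k) = - (q - 1) * H k / (q * real k)"
      using q k by (simp add: field_simps)
    also have "\<dots> \<le> q * (ln K + real k * ln t) / (q * real k)"
      using le' q k by (intro divide_right_mono) auto
    also have "q * (ln K + real k * ln t) / (q * real k) = ln K / real k + ln t"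
      using q k by (simp add: add_divide_distrib)
    finally show ?thesis .
  qed
  then have "\<forall>\<^sub>F k in sequentially. - ((q - 1) / q) * (H k / real k) \<le> ln K / real k + ln t"
    by (rule eventually_mono[OF eventually_gt_at_top[of "0::nat"]])
  moreover have "(\<lambda>k. - ((q - 1) / q) * (H k / real k)) \<longlonglongrightarrow> - ((q - 1) / q) * h"
    unfolding H_def by (intro tendsto_intros h)
  moreover have "(\<lambda>k. ln K / real k + ln t) \<longlonglongrightarrow> 0 + ln t"
    by (intro tendsto_add tendsto_const lim_const_over_n)
  ultimately have "- ((q - 1) / q) * h \<le> 0 + ln t"
    by (intro tendsto_le[OF sequentially_bot]) auto
  then show ?thesis using t by (simp add: ln_ge_iff)
qed

text \<open>The interpolated norm of \<open>m n\<close> is governed by the sum of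
  \<open>f s * exp (\<epsilon> * X s)\<close>, which is 1 plus \<open>\<epsilon>\<close> times the
  mean \<open>D\<close> of \<open>X\<close> to first order. The \<open>n\<close>-th root of the
  bound is then a growth rate.\<close>

lemma growth_near_1:
  fixes L :: "'g \<Rightarrow> real"
  assumes n: "0 < n" and L: "\<And>s. 0 \<le> L s" and C: "1 \<le> C"
    and RD: "\<And>E S f g c. finite E \<Longrightarrow> finite S \<Longrightarrow> lp_le 2 c g \<Longrightarrow> 0 \<le> c \<Longrightarrow>
      (\<Sum>s\<in>S. (\<Sum>t\<in>E. f t * g (- t + s))\<^sup>2) \<le> C\<^sup>2 * (\<Sum>t\<in>E. (f t * (1 + L t) ^ d)\<^sup>2) * c\<^sup>2"
    and fe: "finite_entropy (m n)" and \<beta>: "0 < \<beta>"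
    and mom: "(\<lambda>s. m n s * (1 + L s) powr \<beta>) summable_on UNIV"
    and \<Lambda>: "((\<lambda>s. m n s * ln (1 + L s)) has_sum \<Lambda>) UNIV"
  shows "\<forall>\<^sub>F \<epsilon> in at_right 0. growth (1 + \<epsilon>)
    (exp (\<epsilon> * (2 * real d * \<Lambda> + 1 + 2 * ln C - shannon_entropy (m n)) / ((1 + \<epsilon>) * real n)))"
proof -
  define f where "f = m n"
  define \<omega> where "\<omega> t = (1 + L t) ^ d" for t
  define X where "X s = ln (f s) + 2 * real d * ln (1 + L s)" for s
  define D where "D = - shannon_entropy f + 2 * real d * \<Lambda>"
  \<comment> \<open>Chosen so that \<open>\<omega> powr (2 * \<epsilon>0)\<close> is at most
    \<open>(1 + L) powr \<beta>\<close>; the added 1 avoids division by zero when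
    \<open>d = 0\<close>.\<close>
  define \<epsilon>0 where "\<epsilon>0 = \<beta> / (2 * real d + 1)"
  have \<epsilon>0: "0 < \<epsilon>0" "\<epsilon>0 * (2 * real d) \<le> \<beta>" using \<beta> by (auto simp: \<epsilon>0_def field_simps)
  have L1: "0 < 1 + L s" for s using L[of s] by simp
  have \<omega>0: "0 < \<omega> t" for t using L1 by (simp add: \<omega>_def)
  have f0: "0 \<le> f s" "f s \<le> 1" for s using prob_measure_le_1[OF prob_m] by (auto simp: f_def)
  have fX: "((\<lambda>s. f s * X s) has_sum D) UNIV"
  proof -
    have "((\<lambda>s. - (f s * - ln (f s)) + 2 * real d * (f s * ln (1 + L s))) has_sum D) UNIV"
      unfolding D_def using has_sum_entropy[OF fe] \<Lambda>
      by (intro has_sum_add has_sum_cmult_right has_sum_uminusI) (auto simp: f_def)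
    then show ?thesis by (simp add: X_def algebra_simps)
  qed
  have P_eq: "f s powr (1 + \<epsilon>) * \<omega> s powr (2 * \<epsilon>) = f s * exp (\<epsilon> * X s)" for s \<epsilon>
  proof (cases "f s = 0")
    case False
    then have "0 < f s" using f0[of s] by simp
    then have "f s powr (1 + \<epsilon>) = f s * exp (\<epsilon> * ln (f s))"
      by (simp add: powr_add powr_def[of _ \<epsilon>])
    moreover have "\<omega> s powr (2 * \<epsilon>) = exp (\<epsilon> * (2 * real d * ln (1 + L s)))"
      using L1[of s] \<omega>0[of s] by (simp add: powr_def \<omega>_def ln_realpow)
    ultimately show ?thesis by (simp add: X_def distrib_left exp_add)
  qed auto
  have sum: "(\<lambda>s. f s * exp (\<epsilon>0 * X s)) summable_on UNIV"
  proof (rule summable_on_comparison_test[OF mom])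
    fix s
    have "ln (f s) \<le> 0" using f0[of s] by (cases "f s = 0") auto
    then have "\<epsilon>0 * ln (f s) \<le> 0" using \<epsilon>0 by (simp add: mult_nonneg_nonpos)
    moreover have "\<epsilon>0 * (2 * real d) * ln (1 + L s) \<le> \<beta> * ln (1 + L s)"
      using \<epsilon>0 L[of s] by (intro mult_right_mono) auto
    ultimately have "exp (\<epsilon>0 * X s) \<le> (1 + L s) powr \<beta>"
      using L1[of s] by (simp add: X_def powr_def distrib_left)
    then show "f s * exp (\<epsilon>0 * X s) \<le> m n s * (1 + L s) powr \<beta>"
      using f0 by (simp add: f_def mult_left_mono)
  qed (use f0 in simp)
  have f1: "(f has_sum 1) UNIV" unfolding f_def by (rule has_sum_m)
  \<comment> \<open>The slack is fixed at 1; it disappears later after division by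
    \<open>n\<close>.\<close>
  have "\<forall>\<^sub>F \<epsilon> in at_right 0. (\<lambda>s. f s * exp (\<epsilon> * X s)) summable_on UNIV \<and>
    (\<Sum>\<^sub>\<infinity>s. f s * exp (\<epsilon> * X s)) \<le> exp (\<epsilon> * (D + 1))"
    by (rule infsum_exp_le[OF f0(1) f1 fX \<epsilon>0(1) sum]) simp
  moreover have "\<forall>\<^sub>F \<epsilon> in at_right (0::real). 0 < \<epsilon> \<and> \<epsilon> < 1"
    using eventually_at_right_real[of 0 "1::real"] by simp
  ultimately show ?thesis
  proof eventually_elim
    case (elim \<epsilon>)
    define s where "s = exp (\<epsilon> * (2 * real d * \<Lambda> + 1 + 2 * ln C - shannon_entropy (m n)) / ((1 + \<epsilon>) * real n))"
    have "op_le (1 + \<epsilon>) ((exp (\<epsilon> * (D + 1)) * C powr (2 * \<epsilon>)) powr (1 / (1 + \<epsilon>))) f"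
    proof (rule op_le_interpolation[where \<omega> = \<omega>, OF C])
      fix E :: "'g set" assume E: "finite E"
      have "(\<Sum>t\<in>E. f t * exp (\<epsilon> * X t)) \<le> (\<Sum>\<^sub>\<infinity>s. f s * exp (\<epsilon> * X s))"
        using elim E f0 by (intro finite_sum_le_infsum) auto
      then show "(\<Sum>t\<in>E. f t powr (1 + \<epsilon>) * \<omega> t powr (2 * \<epsilon>)) \<le> exp (\<epsilon> * (D + 1))"
        using elim by (simp add: P_eq)
    qed (use RD \<omega>0 f0 f1 elim in \<open>auto simp: \<omega>_def has_sum_iff\<close>)
    also have "(exp (\<epsilon> * (D + 1)) * C powr (2 * \<epsilon>)) powr (1 / (1 + \<epsilon>)) = s ^ n"
    proof -
      have "exp (\<epsilon> * (D + 1)) * C powr (2 * \<epsilon>) = exp (\<epsilon> * (D + 1 + 2 * ln C))"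
        using C by (simp add: powr_def exp_add[symmetric] algebra_simps)
      then have "(exp (\<epsilon> * (D + 1)) * C powr (2 * \<epsilon>)) powr (1 / (1 + \<epsilon>)) = exp (\<epsilon> * (D + 1 + 2 * ln C) / (1 + \<epsilon>))"
        by (simp add: powr_def)
      moreover have "s ^ n = exp (real n * (\<epsilon> * (2 * real d * \<Lambda> + 1 + 2 * ln C - shannon_entropy (m n)) / ((1 + \<epsilon>) * real n)))"
        by (simp only: s_def exp_of_nat_mult)
      moreover have "real n * (\<epsilon> * (2 * real d * \<Lambda> + 1 + 2 * ln C - shannon_entropy (m n)) / ((1 + \<epsilon>) * real n)) =
          \<epsilon> * (D + 1 + 2 * ln C) / (1 + \<epsilon>)"
        using n by (simp add: D_def f_def)
      ultimately show ?thesis by simp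
    qed
    finally have "op_le (1 + \<epsilon>) (s ^ n) (m n)" by (simp add: f_def)
    then have "growth (1 + \<epsilon>) s"
      using n elim by (intro growth_if_op_le) (auto simp: s_def)
    then show ?case by (simp add: s_def)
  qed
qed

end

section \<open>The two halves of the limit in \<open>p\<close>\<close>

theorem theorem5p2:
  fixes L :: "'g::{group_add, countable} \<Rightarrow> real"
    and \<mu> :: "'g \<Rightarrow> real"
    and \<alpha> :: real
  assumes "length_function L"
    and "property_RD L"
    and "prob_measure \<mu>"
    and "finite_entropy \<mu>"
    and "\<alpha> > 0"
    and "(\<lambda>s. \<mu> s * (1 + L s) powr \<alpha>) summable_on UNIV"
  shows "\<exists>h. avez_seq \<mu> \<longlonglongrightarrow> h \<and> (conv_entropy_fun \<mu> \<longlongrightarrow> h) at_top"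
proof -
  interpret random_walk \<mu> by unfold_locales (rule assms)
  define H where "H n = shannon_entropy (m n)" for n
  have fe: "finite_entropy (m n)" for n by (rule finite_entropy_m) (rule assms)
  have sub: "H (j + k) \<le> H j + H k" for j k
    unfolding H_def m_add by (rule entropy_conv(2)[OF prob_m fe prob_m fe])
  have H0: "0 \<le> H n" for n unfolding H_def by (rule shannon_entropy_nonneg[OF prob_m])
  obtain h where h: "(\<lambda>n. H n / real n) \<longlonglongrightarrow> h" "\<And>n. 0 < n \<Longrightarrow> h \<le> H n / real n"
    using subadditive_limit[of H, OF sub H0] by blast
  have L: "0 \<le> L s" "L (s + t) \<le> L s + L t" "L 0 = 0" for s t
    using assms(1) by (auto simp: length_function_def)
  obtain d C where C: "1 \<le> C" and RD: "\<And>E S f g c. finite E \<Longrightarrow> finite S \<Longrightarrow> lp_le 2 c g \<Longrightarrow> 0 \<le> c \<Longrightarrow>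
      (\<Sum>s\<in>S. (\<Sum>t\<in>E. f t * g (- t + s))\<^sup>2) \<le> C\<^sup>2 * (\<Sum>t\<in>E. (f t * (1 + L t) ^ d)\<^sup>2) * c\<^sup>2"
    by (rule property_RD_real[OF assms(2)]) (rule that)
  \<comment> \<open>An exponent at most 1 makes \<open>w\<close> subadditive, and lowering it keeps
    the moment finite because \<open>1 + L \<ge> 1\<close>.\<close>
  define \<beta> where "\<beta> = min \<alpha> 1"
  have \<beta>: "0 < \<beta>" "\<beta> \<le> 1" "\<beta> \<le> \<alpha>" using assms(5) by (auto simp: \<beta>_def)
  define w where "w s = (1 + L s) powr \<beta>" for s
  have w1: "1 \<le> w s" for s unfolding w_def using L(1)[of s] \<beta> by (intro ge_one_powr_ge_zero) auto
  have wn: "0 \<le> w s" for s by (simp add: w_def)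
  have w0: "w 0 = 1" by (simp add: w_def L(3))
  have w_add: "w (s + t) \<le> w s + w t" for s t
  proof -
    have "w (s + t) \<le> ((1 + L s) + (1 + L t)) powr \<beta>"
      unfolding w_def using L(2)[of s t] L(1)[of "s + t"] \<beta> by (intro powr_mono2) auto
    also have "\<dots> \<le> w s + w t"
      unfolding w_def using L(1)[of s] L(1)[of t] \<beta> by (intro powr_add_le) auto
    finally show ?thesis .
  qed
  define M where "M = (\<Sum>\<^sub>\<infinity>s. \<mu> s * w s)"
  have \<mu>w: "(\<lambda>s. \<mu> s * w s) summable_on UNIV"
  proof (rule summable_on_comparison_test[OF assms(6)])
    show "\<mu> s * w s \<le> \<mu> s * (1 + L s) powr \<alpha>" for s
      unfolding w_def using L(1)[of s] \<beta> by (intro mult_left_mono powr_mono) auto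
  qed (simp add: w_def)
  have M: "((\<lambda>s. \<mu> s * w s) has_sum M) UNIV" unfolding M_def by (rule has_sum_infsum[OF \<mu>w])
  have M0: "0 \<le> M" unfolding M_def by (intro infsum_nonneg) (simp add: w_def)
  have mom: "(\<lambda>s. m n s * w s) summable_on UNIV" "(\<Sum>\<^sub>\<infinity>s. m n s * w s) \<le> 1 + real n * M" for n
    using moment_conv_pow[OF wn w0 w_add M, of n] by auto
  define \<Lambda> where "\<Lambda> n = (\<Sum>\<^sub>\<infinity>s. m n s * ln (1 + L s))" for n
  have ln_w: "ln (w s) = \<beta> * ln (1 + L s)" for s using L(1)[of s] by (simp add: w_def ln_powr)
  have \<Lambda>: "((\<lambda>s. m n s * ln (1 + L s)) has_sum \<Lambda> n) UNIV" "\<Lambda> n \<le> ln (1 + real n * M) / \<beta>" for n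
  proof -
    have "0 < 1 + real n * M" using M0 by (simp add: add_pos_nonneg)
    note ln = infsum_ln_le[OF prob_m w1 mom this, unfolded ln_w]
    have "(\<lambda>s. 1 / \<beta> * (m n s * (\<beta> * ln (1 + L s)))) summable_on UNIV"
      by (rule summable_on_cmult_right[OF ln(1)])
    then show 1: "((\<lambda>s. m n s * ln (1 + L s)) has_sum \<Lambda> n) UNIV"
      unfolding \<Lambda>_def using \<beta> by (intro has_sum_infsum) simp
    have "\<beta> * \<Lambda> n \<le> ln (1 + real n * M)"
      using ln(2) by (simp add: \<Lambda>_def mult.left_commute[of _ \<beta>] infsum_cmult_right')
    then show "\<Lambda> n \<le> ln (1 + real n * M) / \<beta>" using \<beta> by (simp add: field_simps)
  qed
  have avez: "avez_seq \<mu> = (\<lambda>n. H n / real n)" by (simp add: avez_seq_def H_def fun_eq_iff)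
  have lower: "exp (- ((q - 1) / q) * h) \<le> t" if "1 < q" "growth q t" for q t
    by (rule exp_le_growth[OF assms(4) _ that]) (use h in \<open>simp add: H_def\<close>)
  have q: "1 < p / (p - 1)" "(p / (p - 1) - 1) / (p / (p - 1)) = 1 / p" "p / (p - 1) = 1 + 1 / (p - 1)"
    if "1 < p" for p :: real using that by (auto simp: field_simps)
  have r_ge: "exp (- (1 / p) * h) \<le> PF_spectral_radius (p / (p - 1)) \<mu>c" if p: "1 < p" for p
  proof (rule PF_spectral_radius_bounds(1)[OF less_imp_le[OF q(1)[OF p]] exp_gt_zero])
    show "exp (- (1 / p) * h) \<le> t" if "growth (p / (p - 1)) t" for t
      using lower[OF q(1)[OF p] that] unfolding q(2)[OF p] .
  qed
  have upper: "conv_entropy_fun \<mu> p \<le> h" if p: "1 < p" for p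
  proof -
    have "- (1 / p) * h \<le> ln (PF_spectral_radius (p / (p - 1)) \<mu>c)"
      using ln_mono[OF r_ge[OF p]] by simp
    then have "p * (- (1 / p) * h) \<le> p * ln (PF_spectral_radius (p / (p - 1)) \<mu>c)"
      using p by (intro mult_left_mono) auto
    then show ?thesis using p by (simp add: conv_entropy_fun_def)
  qed
  have "(conv_entropy_fun \<mu> \<longlongrightarrow> h) at_top"
  proof (rule order_tendstoI)
    fix a assume "h < a"
    then have "conv_entropy_fun \<mu> p < a" if "1 < p" for p using upper[OF that] by simp
    then show "\<forall>\<^sub>F p in at_top. conv_entropy_fun \<mu> p < a"
      by (rule eventually_mono[OF eventually_gt_at_top])
  next
    fix a assume a: "a < h"
    \<comment> \<open>Everything in the growth bound except the entropy. As the logarithmic moment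
      grows at most like \<open>ln n\<close>, \<open>R n / n\<close> is eventually below any
      positive number.\<close>
    define R where "R n = 2 * real d * \<Lambda> n + 1 + 2 * ln C" for n
    have "\<forall>\<^sub>F n in sequentially. R n / real n < h - a"
    proof -
      have bound: "R n / real n \<le> 2 * real d / \<beta> * (ln (real n) / real n) + (2 * real d / \<beta> * ln (1 + M) + 1 + 2 * ln C) / real n"
        if n: "0 < n" for n
      proof -
        have "1 + real n * M \<le> real n * (1 + M)" using n by (simp add: distrib_left)
        then have "ln (1 + real n * M) \<le> ln (real n * (1 + M))"
          using M0 by (intro ln_mono) (auto simp: add_pos_nonneg)
        also have "\<dots> = ln (real n) + ln (1 + M)" using n M0 by (simp add: ln_mult)
        finally have "ln (1 + real n * M) / \<beta> \<le> (ln (real n) + ln (1 + M)) / \<beta>"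
          using \<beta> by (intro divide_right_mono) auto
        with \<Lambda>(2)[of n] have "\<Lambda> n \<le> (ln (real n) + ln (1 + M)) / \<beta>" by simp
        then have "2 * real d * \<Lambda> n \<le> 2 * real d * ((ln (real n) + ln (1 + M)) / \<beta>)"
          by (intro mult_left_mono) auto
        then have "R n \<le> 2 * real d * ((ln (real n) + ln (1 + M)) / \<beta>) + 1 + 2 * ln C"
          by (simp add: R_def)
        then have "R n / real n \<le> (2 * real d * ((ln (real n) + ln (1 + M)) / \<beta>) + 1 + 2 * ln C) / real n"
          by (intro divide_right_mono) auto
        also have "\<dots> = 2 * real d / \<beta> * (ln (real n) / real n) + (2 * real d / \<beta> * ln (1 + M) + 1 + 2 * ln C) / real n"
          by (simp add: add_divide_distrib distrib_left)
        finally show ?thesis .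
      qed
      have "(\<lambda>n. 2 * real d / \<beta> * (ln (real n) / real n) + (2 * real d / \<beta> * ln (1 + M) + 1 + 2 * ln C) / real n)
          \<longlonglongrightarrow> 2 * real d / \<beta> * 0 + 0"
        by (intro tendsto_add tendsto_mult tendsto_const lim_ln_over_n lim_const_over_n)
      then have "\<forall>\<^sub>F n in sequentially. 2 * real d / \<beta> * (ln (real n) / real n) + (2 * real d / \<beta> * ln (1 + M) + 1 + 2 * ln C) / real n < h - a"
        using a by (intro order_tendstoD) auto
      then show ?thesis
        using eventually_gt_at_top[of "0::nat"] by eventually_elim (rule le_less_trans[OF bound])
    qed
    then have "\<forall>\<^sub>F n in sequentially. R n / real n < h - a \<and> 0 < n"
      using eventually_gt_at_top[of "0::nat"] by (rule eventually_conj)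
    \<comment> \<open>\<open>n\<close> is fixed first, according to the gap \<open>h - a\<close>;
      only then is \<open>\<epsilon>\<close> made small, so the threshold \<open>b\<close> may
      depend on \<open>n\<close>.\<close>
    then obtain n where n: "R n / real n < h - a" "0 < n"
      by (auto simp: eventually_sequentially)
    have "\<forall>\<^sub>F \<epsilon> in at_right 0. growth (1 + \<epsilon>) (exp (\<epsilon> * (R n - H n) / ((1 + \<epsilon>) * real n)))"
      unfolding R_def H_def using growth_near_1[OF n(2) L(1) C RD fe \<beta>(1) mom(1)[unfolded w_def] \<Lambda>(1)] .
    then obtain b where b: "0 < b" "\<And>\<epsilon>. 0 < \<epsilon> \<Longrightarrow> \<epsilon> < b \<Longrightarrow> growth (1 + \<epsilon>) (exp (\<epsilon> * (R n - H n) / ((1 + \<epsilon>) * real n)))"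
      by (auto simp: eventually_at_right_field)
    \<comment> \<open>The condition on \<open>p\<close> says that
      \<open>\<epsilon> = 1 / (p - 1)\<close> is below \<open>b\<close>.\<close>
    have "a < conv_entropy_fun \<mu> p" if p: "1 + 1 / b < p" for p
    proof -
      have p1: "1 < p" using p b(1) by (smt (verit) divide_pos_pos)
      define r where "r = PF_spectral_radius (p / (p - 1)) \<mu>c"
      define \<epsilon> where "\<epsilon> = 1 / (p - 1)"
      have \<epsilon>: "0 < \<epsilon>" "\<epsilon> < b" using p p1 b(1) by (auto simp: \<epsilon>_def field_simps)
      have q\<epsilon>: "p / (p - 1) = 1 + \<epsilon>" using q(3)[OF p1] by (simp add: \<epsilon>_def)
      have "r \<le> exp (\<epsilon> * (R n - H n) / ((1 + \<epsilon>) * real n))"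
        unfolding r_def q\<epsilon>
        using PF_spectral_radius_bounds(2)[of "1 + \<epsilon>" "exp (- (\<epsilon> / (1 + \<epsilon>)) * h)"] lower[of "1 + \<epsilon>"] b(2)[OF \<epsilon>] \<epsilon>
        by simp
      also have "\<epsilon> * (R n - H n) / ((1 + \<epsilon>) * real n) = (R n - H n) / real n / p"
        using p1 n(2) by (simp add: \<epsilon>_def field_simps)
      finally have "r \<le> exp ((R n - H n) / real n / p)" .
      \<comment> \<open>Positivity, needed to take logarithms, comes from the entropy lower bound on
        the spectral radius.\<close>
      moreover have "0 < r" unfolding r_def by (rule less_le_trans[OF exp_gt_zero r_ge[OF p1]])
      ultimately have "ln r \<le> (R n - H n) / real n / p" using ln_mono[of r "exp ((R n - H n) / real n / p)"] by simp
      then have "ln r * p \<le> (R n - H n) / real n" using p1 by (subst (asm) pos_le_divide_eq) auto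
      then have "p * ln r \<le> (R n - H n) / real n" by (simp only: mult.commute)
      then have "H n / real n - R n / real n \<le> conv_entropy_fun \<mu> p"
        by (simp add: conv_entropy_fun_def r_def diff_divide_distrib)
      with h(2)[OF n(2)] n(1) show ?thesis by linarith
    qed
    then show "\<forall>\<^sub>F p in at_top. a < conv_entropy_fun \<mu> p"
      by (rule eventually_mono[OF eventually_gt_at_top])
  qed
  with h(1) show ?thesis by (auto simp: avez)
qed

end
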